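(* Let $G$ be a simple graph of order $n\geq 4$ such that both $G$ and its complement $\overline{G}$ are connected. Then $trc(G)+trc(\overline{G})=2n+2$ if $n=4$; $trc(G)+trc(\overline{G})\leq 2n+1$ if $n=5$; and $trc(G)+trc(\overline{G})\leq 2n$ if $n\geq 6$. Moreover, these upper bounds are tight: for every $n\geq 5$ there exists a graph $G$ of order $n$ with $G$ and $\overline{G}$ connected attaining the corresponding bound.
   Context: All graphs are finite, simple and undirected. A total-coloring of a graph assigns colors to all its vertices and edges. In a total-colored graph, a path is total-rainbow if all its edges and all its internal vertices receive pairwise distinct colors. The graph is total-rainbow connected if every pair of distinct vertices is joined by a total-rainbow path. For a connected graph $G$, the total-rainbow connection number $trc(G)$ is the minimum number of colors in a total-coloring of $G$ making $G$ total-rainbow connected. *)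

theory Defs
  imports Complex_Main
begin

definition simple_graph :: "'a set \<Rightarrow> 'a set set \<Rightarrow> bool" where
  "simple_graph V E \<longleftrightarrow> finite V \<and> (\<forall>e\<in>E. e \<subseteq> V \<and> card e = 2)"

definition complement_edges :: "'a set \<Rightarrow> 'a set set \<Rightarrow> 'a set set" where
  "complement_edges V E = {e. e \<subseteq> V \<and> card e = 2 \<and> e \<notin> E}"

fun path_edges :: "'a list \<Rightarrow> 'a set list" where
  "path_edges (u # v # p) = {u, v} # path_edges (v # p)"
| "path_edges _ = []"

definition internal_vertices :: "'a list \<Rightarrow> 'a list" where
  "internal_vertices p = butlast (tl p)"

definition path_between :: "'a set \<Rightarrow> 'a set set \<Rightarrow> 'a \<Rightarrow> 'a list \<Rightarrow> 'a \<Rightarrow> bool" where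
  "path_between V E u p v \<longleftrightarrow>
     p \<noteq> [] \<and> hd p = u \<and> last p = v \<and> distinct p \<and> set p \<subseteq> V \<and> set (path_edges p) \<subseteq> E"

definition connected_graph :: "'a set \<Rightarrow> 'a set set \<Rightarrow> bool" where
  "connected_graph V E \<longleftrightarrow> V \<noteq> {} \<and> (\<forall>u\<in>V. \<forall>v\<in>V. \<exists>p. path_between V E u p v)"

text \<open>A total-coloring is a function on the disjoint sum of vertices (\<open>Inl\<close>) and edges (\<open>Inr\<close>);
  it need not be proper, and its values outside the graph are irrelevant. As graphs are finite,
  taking natural numbers as colors is no restriction.\<close>

type_synonym 'a total_coloring = "'a + 'a set \<Rightarrow> nat"

definition colors_used :: "'a set \<Rightarrow> 'a set set \<Rightarrow> 'a total_coloring \<Rightarrow> nat set" where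
  "colors_used V E c = c ` (Inl ` V \<union> Inr ` E)"

definition total_rainbow :: "'a total_coloring \<Rightarrow> 'a list \<Rightarrow> bool" where
  "total_rainbow c p \<longleftrightarrow>
     distinct (map c (map Inr (path_edges p) @ map Inl (internal_vertices p)))"

definition total_rainbow_connected :: "'a set \<Rightarrow> 'a set set \<Rightarrow> 'a total_coloring \<Rightarrow> bool" where
  "total_rainbow_connected V E c \<longleftrightarrow>
     (\<forall>u\<in>V. \<forall>v\<in>V. u \<noteq> v \<longrightarrow> (\<exists>p. path_between V E u p v \<and> total_rainbow c p))"

definition trc :: "'a set \<Rightarrow> 'a set set \<Rightarrow> nat" where
  "trc V E = (LEAST k. \<exists>c. total_rainbow_connected V E c \<and> card (colors_used V E c) = k)"

end

theory Submission
  imports Defs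
begin

text \<open>
  The bound is proved for total-colorings in which, in addition, no vertex has the color of an
  incident edge; this extra property makes paths of length two extendable. Let \<open>v\<close> be a vertex
  whose deletion keeps both graphs connected; it exists for order at least five, because a cut
  vertex of one graph makes the rest of the other one a join. One of the graphs, say \<open>F\<close>, has all
  vertices within distance two of \<open>v\<close>. Let \<open>d\<close> be the number of non-neighbors of \<open>v\<close> in \<open>F\<close>. A coloring
  of \<open>F - v\<close> with \<open>k > d\<close> colors extends to \<open>F\<close> without a new color, provided that the non-neighbors
  are not all reached through the same neighbor of \<open>v\<close>, and a coloring of \<open>E - v\<close> extends to \<open>E\<close>
  with two new colors, so the sum grows by at most two. If \<open>F - v\<close> needs at most \<open>d\<close> colors, then
  \<open>d + 1\<close> colors suffice for \<open>F\<close>, and \<open>E\<close>, having a vertex of degree \<open>d\<close>, needs at most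
  \<open>2 n - 1 - d\<close> colors. The induction starts at order six; there only the extensions of the fork,
  the unique exceptional graph of order five, need explicit colorings. The bounds are attained by
  paths and, for order five, by the fork.
\<close>

subsection \<open>Paths and connectivity\<close>

lemma path_edges_Cons: "q \<noteq> [] \<Longrightarrow> path_edges (x # q) = {x, hd q} # path_edges q"
  by (cases q) auto

lemma path_edges_snoc: "p \<noteq> [] \<Longrightarrow> path_edges (p @ [x]) = path_edges p @ [{last p, x}]"
  by (induction p rule: path_edges.induct) auto

lemma path_edges_rev: "path_edges (rev p) = rev (path_edges p)"
proof (induction p)
  case (Cons x p)
  then show ?case
    by (cases "p = []") (simp_all add: path_edges_snoc path_edges_Cons last_rev insert_commute)
qed simp

lemma internal_vertices_rev: "internal_vertices (rev p) = rev (internal_vertices p)"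
proof (cases p rule: rev_cases)
  case (snoc q x)
  then show ?thesis by (cases q) (simp_all add: internal_vertices_def butlast_append butlast_rev)
qed (simp add: internal_vertices_def)

lemma set_path_edges_subset: "e \<in> set (path_edges p) \<Longrightarrow> e \<subseteq> set p"
  by (induction p rule: path_edges.induct) auto

lemma length_path_edges: "length (path_edges p) = length p - 1"
  by (induction p rule: path_edges.induct) auto

lemma set_path_edges_append: "set (path_edges (p @ [y])) \<subseteq> set (path_edges (p @ y # q))"
  by (induction p rule: path_edges.induct) (auto simp: neq_Nil_conv split: list.splits)

lemma internal_vertices_subset: "set (internal_vertices p) \<subseteq> set p"
  unfolding internal_vertices_def by (cases p) (auto dest: in_set_butlastD)

lemma path_between_rev: "path_between V E u p v \<Longrightarrow> path_between V E v (rev p) u"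
  by (auto simp: path_between_def path_edges_rev hd_rev last_rev)

lemma total_rainbow_rev: "total_rainbow c (rev p) \<longleftrightarrow> total_rainbow c p"
  unfolding total_rainbow_def path_edges_rev internal_vertices_rev
  by (simp add: rev_map[symmetric] Int_commute)

lemma total_rainbow_edge: "total_rainbow c [u, v]"
  by (simp add: total_rainbow_def internal_vertices_def)

lemma path_between_edge: "{u, v} \<in> E \<Longrightarrow> u \<noteq> v \<Longrightarrow> u \<in> V \<Longrightarrow> v \<in> V \<Longrightarrow> path_between V E u [u, v] v"
  by (simp add: path_between_def)

lemma total_rainbow_two_edges:
  "total_rainbow c [u, w, v] \<longleftrightarrow> distinct [c (Inr {u, w}), c (Inl w), c (Inr {w, v})]"
  by (auto simp: total_rainbow_def internal_vertices_def)

lemma total_rainbow_Cons: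
  assumes "path_between V E w q u" "u \<noteq> w"
  shows "total_rainbow c (x # q) \<longleftrightarrow> total_rainbow c q \<and> c (Inr {x, w}) \<noteq> c (Inl w) \<and>
    c (Inr {x, w}) \<notin> c ` (Inr ` set (path_edges q) \<union> Inl ` set (internal_vertices q)) \<and>
    c (Inl w) \<notin> c ` (Inr ` set (path_edges q) \<union> Inl ` set (internal_vertices q))"
proof -
  obtain q' where q: "q = w # q'" "q' \<noteq> []"
    using assms by (cases q) (auto simp: path_between_def split: if_splits)
  have "internal_vertices (x # q) = w # internal_vertices q"
    using q by (simp add: internal_vertices_def)
  then show ?thesis
    using q by (auto simp: total_rainbow_def path_edges_Cons)
qed

text \<open>Where a recoloring changes the color of a vertex on the path, agreement of the two
  colorings is too strong a hypothesis; it is enough that injectivity on the items of the path is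
  preserved.\<close>

lemma total_rainbow_transfer:
  assumes "total_rainbow c p"
    and "inj_on c (Inr ` set (path_edges p) \<union> Inl ` set (internal_vertices p)) \<Longrightarrow>
         inj_on c' (Inr ` set (path_edges p) \<union> Inl ` set (internal_vertices p))"
  shows "total_rainbow c' p"
proof -
  have *: "set (map Inr (path_edges p) @ map Inl (internal_vertices p)) =
    Inr ` set (path_edges p) \<union> Inl ` set (internal_vertices p)"
    by simp
  show ?thesis
    using assms unfolding total_rainbow_def distinct_map * by blast
qed

lemma total_rainbow_cong:
  assumes "total_rainbow c p" "\<And>e. e \<in> set (path_edges p) \<Longrightarrow> c' (Inr e) = c (Inr e)"
    and "\<And>x. x \<in> set (internal_vertices p) \<Longrightarrow> c' (Inl x) = c (Inl x)"
  shows "total_rainbow c' p"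
proof (rule total_rainbow_transfer[OF assms(1)])
  let ?A = "Inr ` set (path_edges p) \<union> Inl ` set (internal_vertices p)"
  have "c' y = c y" if "y \<in> ?A" for y
    using that assms(2,3) by blast
  then show "inj_on c ?A \<Longrightarrow> inj_on c' ?A"
    by (metis inj_on_cong)
qed

lemma path_between_mono:
  "path_between S E' u p v \<Longrightarrow> S \<subseteq> V \<Longrightarrow> E' \<subseteq> E \<Longrightarrow> path_between V E u p v"
  by (auto simp: path_between_def)

section \<open>Connectivity by cuts and by ranks\<close>

lemma path_crosses:
  "p \<noteq> [] \<Longrightarrow> hd p \<in> S \<Longrightarrow> last p \<notin> S \<Longrightarrow> \<exists>x y. x \<in> S \<and> y \<notin> S \<and> {x, y} \<in> set (path_edges p)"
  by (induction p rule: path_edges.induct) auto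

text \<open>No edge leaves the set of vertices reachable from a fixed \<open>u\<close>, so if every
  proper cut has an edge, this set is all of \<open>V\<close>. As paths must stay inside the vertex
  set, \<open>connected_graph S E\<close> for an \<open>E\<close> with edges outside
  \<open>S\<close> speaks of the subgraph induced by \<open>S\<close>.\<close>

lemma connected_graph_iff_cut:
  "connected_graph V E \<longleftrightarrow> V \<noteq> {} \<and>
     (\<forall>S. S \<subseteq> V \<longrightarrow> S \<noteq> {} \<longrightarrow> S \<noteq> V \<longrightarrow> (\<exists>x\<in>S. \<exists>y\<in>V - S. {x, y} \<in> E))"
    (is "?L \<longleftrightarrow> ?R")
proof
  assume L: ?L
  show ?R
  proof (intro conjI allI impI)
    show "V \<noteq> {}" using L by (simp add: connected_graph_def)
    fix S assume S: "S \<subseteq> V" "S \<noteq> {}" "S \<noteq> V"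
    then obtain u v where "u \<in> S" "v \<in> V" "v \<notin> S" by blast
    then obtain p where p: "path_between V E u p v"
      using L S by (meson connected_graph_def subsetD)
    then obtain x y where xy: "x \<in> S" "y \<notin> S" "{x, y} \<in> set (path_edges p)"
      using path_crosses[of p S] \<open>u \<in> S\<close> \<open>v \<notin> S\<close> by (auto simp: path_between_def)
    moreover have "y \<in> V" using p set_path_edges_subset[OF xy(3)] by (auto simp: path_between_def)
    ultimately show "\<exists>x\<in>S. \<exists>y\<in>V - S. {x, y} \<in> E"
      using p by (auto simp: path_between_def)
  qed
next
  assume R: ?R
  have "\<exists>p. path_between V E u p v" if "u \<in> V" "v \<in> V" for u v
  proof -
    define S where "S = {w \<in> V. \<exists>p. path_between V E u p w}"
    have "path_between V E u [u] u" using that by (simp add: path_between_def)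
    then have "u \<in> S" using that by (auto simp: S_def)
    have "S = V"
    proof (rule ccontr)
      assume "S \<noteq> V"
      then obtain x y where xy: "x \<in> S" "y \<in> V - S" "{x, y} \<in> E"
        using R \<open>u \<in> S\<close> unfolding S_def by (metis (no_types, lifting) empty_iff mem_Collect_eq subsetI)
      then obtain p where p: "path_between V E u p x" by (auto simp: S_def)
      \<comment> \<open>Paths have distinct vertices, so if \<open>y\<close> already lies on
        \<open>p\<close>, the path is cut off at \<open>y\<close> instead of being extended.\<close>
      have "\<exists>p. path_between V E u p y"
      proof (cases "y \<in> set p")
        case True
        then obtain p1 p2 where "p = p1 @ y # p2" by (meson split_list)
        then have "path_between V E u (p1 @ [y]) y"
          using p set_path_edges_append[of p1 y p2] by (cases p1) (auto simp: path_between_def)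
        then show ?thesis by blast
      next
        case False
        then have "path_between V E u (p @ [y]) y"
          using p xy by (auto simp: path_between_def path_edges_snoc)
        then show ?thesis by blast
      qed
      then show False using xy by (auto simp: S_def)
    qed
    then show ?thesis using that by (auto simp: S_def)
  qed
  then show ?L using R by (auto simp: connected_graph_def)
qed

lemma connected_graph_cut:
  assumes "connected_graph V E" "u \<in> S" "S \<subseteq> V" "v \<in> V" "v \<notin> S"
  obtains x y where "x \<in> S" "y \<in> V" "y \<notin> S" "{x, y} \<in> E"
  using assms unfolding connected_graph_iff_cut by blast

text \<open>Descending ranks lead from any vertex to \<open>r\<close>, so a set without
  \<open>r\<close> is left on the way; a set with \<open>r\<close> is handled through its
  complement. Concrete connectivity proofs then reduce to naming one lower neighbor per
  vertex.\<close>

lemma connected_graph_rankI: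
  fixes f :: "'a \<Rightarrow> nat"
  assumes "r \<in> V" "\<And>u. u \<in> V \<Longrightarrow> u \<noteq> r \<Longrightarrow> \<exists>u'\<in>V. {u, u'} \<in> E \<and> f u' < f u"
  shows "connected_graph V E"
proof -
  have cross: "\<exists>x\<in>S. \<exists>y\<in>V - S. {x, y} \<in> E" if "S \<subseteq> V" "u \<in> S" "r \<notin> S" for S u
    using that(2)
  proof (induction "f u" arbitrary: u rule: less_induct)
    case less
    then obtain u' where "u' \<in> V" "{u, u'} \<in> E" "f u' < f u"
      using assms(2)[of u] \<open>S \<subseteq> V\<close> \<open>r \<notin> S\<close> by blast
    then show ?case using less by (cases "u' \<in> S") auto
  qed
  show ?thesis
    unfolding connected_graph_iff_cut
  proof (intro conjI allI impI)
    fix S assume S: "S \<subseteq> V" "S \<noteq> {}" "S \<noteq> V"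
    show "\<exists>x\<in>S. \<exists>y\<in>V - S. {x, y} \<in> E"
    proof (cases "r \<in> S")
      case True
      obtain u where "u \<in> V - S" using S by blast
      then obtain x y where "x \<in> V - S" "y \<in> V - (V - S)" "{y, x} \<in> E"
        using cross[of "V - S" u] True by (auto simp: insert_commute)
      then show ?thesis by blast
    next
      case False
      then show ?thesis using cross S by blast
    qed
  qed (use assms in blast)
qed

lemma connected_graph_insert:
  assumes "connected_graph S E" "s \<in> S" "{s, y} \<in> E'" "E \<subseteq> E'"
  shows "connected_graph (insert y S) E'"
  unfolding connected_graph_iff_cut
proof (intro conjI allI impI)
  fix T assume T: "T \<subseteq> insert y S" "T \<noteq> {}" "T \<noteq> insert y S"
  show "\<exists>x\<in>T. \<exists>z\<in>insert y S - T. {x, z} \<in> E'"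
  proof (cases "T \<inter> S = {} \<or> S \<subseteq> T")
    case True
    then show ?thesis
    proof
      assume "T \<inter> S = {}"
      then have "y \<in> T" "s \<notin> T" using T assms(2) by auto
      then show ?thesis using assms(2,3) by (metis Diff_iff insertCI insert_commute)
    next
      assume "S \<subseteq> T"
      then have "y \<notin> T" "s \<in> T" using T assms(2) by auto
      then show ?thesis using assms(3) by blast
    qed
  next
    case False
    then have "\<exists>x\<in>T \<inter> S. \<exists>z\<in>S - T \<inter> S. {x, z} \<in> E"
      using assms(1) unfolding connected_graph_iff_cut by (metis Int_lower2 inf.absorb_iff2 inf_commute)
    then show ?thesis using assms(4) by blast
  qed
qed simp

subsection \<open>Colorings built from stars\<close>

text \<open>Here \<open>k\<close> bounds all values of \<open>c\<close>, also those outside the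
  graph, and is not the number of colors used; this gives monotonicity in \<open>k\<close> and
  forces \<open>0 < k\<close>. Under the last condition a path of length two is total-rainbow iff
  its two edges have different colors.\<close>

definition colorable :: "'a set \<Rightarrow> 'a set set \<Rightarrow> nat \<Rightarrow> bool" where
  "colorable V E k \<longleftrightarrow> (\<exists>c. total_rainbow_connected V E c \<and> (\<forall>y. c y < k) \<and>
     (\<forall>e\<in>E. \<forall>x\<in>e. c (Inl x) \<noteq> c (Inr e)))"

lemma colorable_le: "colorable V E k \<Longrightarrow> k \<le> l \<Longrightarrow> colorable V E l"
  unfolding colorable_def by (meson order_less_le_trans)

lemma total_rainbow_connected_symI:
  assumes "\<And>u v. u \<in> V \<Longrightarrow> v \<in> V \<Longrightarrow> u \<noteq> v \<Longrightarrow>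
    \<exists>p. (path_between V E u p v \<or> path_between V E v p u) \<and> total_rainbow c p"
  shows "total_rainbow_connected V E c"
  unfolding total_rainbow_connected_def
  by (meson assms path_between_rev total_rainbow_rev)

lemma ex_color_avoiding:
  fixes A :: "nat set"
  assumes "finite A" "card A < k"
  shows "\<exists>a<k. a \<notin> A"
proof (rule ccontr)
  assume "\<not> ?thesis"
  then have "{..<k} \<subseteq> A" by auto
  then have "card {..<k} \<le> card A" by (rule card_mono[OF assms(1)])
  then show False using assms(2) by simp
qed

text \<open>Old paths keep their colors; each added edge takes a color different from those of its
  two ends, hence the three colors.\<close>

lemma colorable_supergraph:
  assumes "colorable V E' k" "E' \<subseteq> E" "\<And>e. e \<in> E \<Longrightarrow> card e = 2" "3 \<le> k"
  shows "colorable V E k"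
proof -
  obtain c where c: "total_rainbow_connected V E' c" "\<And>y. c y < k"
    "\<And>e x. e \<in> E' \<Longrightarrow> x \<in> e \<Longrightarrow> c (Inl x) \<noteq> c (Inr e)"
    using assms(1) unfolding colorable_def by blast
  have "\<exists>a<k. a \<notin> (\<lambda>x. c (Inl x)) ` e" if "e \<in> E" for e
  proof (rule ex_color_avoiding)
    have "finite e" using assms(3)[OF that] by (metis card.infinite zero_neq_numeral)
    then show "finite ((\<lambda>x. c (Inl x)) ` e)" "card ((\<lambda>x. c (Inl x)) ` e) < k"
      using assms(3)[OF that] assms(4) card_image_le[of e "\<lambda>x. c (Inl x)"] by auto
  qed
  then obtain h where h: "\<And>e. e \<in> E \<Longrightarrow> h e < k" "\<And>e. e \<in> E \<Longrightarrow> h e \<notin> (\<lambda>x. c (Inl x)) ` e"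
    by metis
  define c' where "c' y = (case y of Inl x \<Rightarrow> c (Inl x) | Inr e \<Rightarrow>
      if e \<in> E - E' then h e else c (Inr e))" for y
  have "\<exists>p. path_between V E u p v \<and> total_rainbow c' p" if uv: "u \<in> V" "v \<in> V" "u \<noteq> v" for u v
  proof -
    obtain p where p: "path_between V E' u p v" "total_rainbow c p"
      using c(1) uv unfolding total_rainbow_connected_def by blast
    have "set (path_edges p) \<subseteq> E'" using p(1) by (simp add: path_between_def)
    then have "total_rainbow c' p"
      by (intro total_rainbow_cong[OF p(2)]) (auto simp: c'_def)
    then show ?thesis using path_between_mono[OF p(1) subset_refl assms(2)] by blast
  qed
  then have "total_rainbow_connected V E c'"
    unfolding total_rainbow_connected_def by blast
  moreover have "c' y < k" for y
    using c(2) h(1) by (auto simp: c'_def split: sum.split)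
  moreover have "c' (Inl x) \<noteq> c' (Inr e)" if "e \<in> E" "x \<in> e" for e x
    using that c(3)[of e x] h(2)[of e] by (auto simp: c'_def image_iff)
  ultimately show ?thesis unfolding colorable_def by blast
qed

text \<open>The color \<open>k\<close> goes to \<open>w\<close> and to the new leaves, and each new
  edge gets its own color above \<open>k\<close>, so a path entering \<open>S\<close> through
  \<open>w\<close> stays rainbow. The bound on \<open>c\<close> omits \<open>w\<close>, which is
  recolored anyway; a single vertex thus qualifies with \<open>k = 0\<close> and yields the
  stars.\<close>

lemma colorable_add_pendants:
  assumes c: "total_rainbow_connected S E c"
    "\<And>x. x \<in> S - {w} \<Longrightarrow> c (Inl x) < k" "\<And>e. e \<in> E \<Longrightarrow> c (Inr e) < k"
    "\<And>e x. e \<in> E \<Longrightarrow> x \<in> e \<Longrightarrow> c (Inl x) \<noteq> c (Inr e)"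
    and E: "\<And>e. e \<in> E \<Longrightarrow> e \<subseteq> S"
    and w: "w \<in> S" and X: "finite X" "X \<inter> S = {}"
  shows "colorable (S \<union> X) (E \<union> (\<lambda>x. {w, x}) ` X) (k + card X + 1)"
proof -
  let ?P = "(\<lambda>x. {w, x}) ` X"
  let ?V = "S \<union> X" and ?E = "E \<union> ?P"
  have "inj_on (\<lambda>x. {w, x}) X" by (auto simp: inj_on_def doubleton_eq_iff)
  then have "card ?P = card X" by (rule card_image)
  then obtain g where g: "bij_betw g ?P {..<card X}"
    using X(1) by (metis ex_bij_betw_finite_nat finite_imageI atLeast0LessThan)
  then have g_less: "g e < card X" if "e \<in> ?P" for e
    using that bij_betwE by fastforce
  have PE: "e \<notin> E" if "e \<in> ?P" for e using that E X(2) by blast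
  define c' where "c' y = (case y of Inl x \<Rightarrow> if x \<in> S - {w} then c (Inl x) else k
      | Inr e \<Rightarrow> if e \<in> E then c (Inr e) else if e \<in> ?P then k + 1 + g e else k)" for y
  have c'_w: "c' (Inl w) = k" by (simp add: c'_def)
  have c'_P: "c' (Inr {w, x}) = k + 1 + g {w, x}" if "x \<in> X" for x
    using that PE[of "{w, x}"] by (auto simp: c'_def)
  have c'_old: "c' (Inl x) = c (Inl x)" "c' (Inl x) < k" if "x \<in> S" "x \<noteq> w" for x
    using that c(2)[of x] by (auto simp: c'_def)
  have c'_E: "c' (Inr e) = c (Inr e)" "c' (Inr e) < k" if "e \<in> E" for e
    using that c(3)[of e] by (auto simp: c'_def)
  \<comment> \<open>Inside \<open>S\<close> only \<open>w\<close> changes its color, and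
    \<open>k\<close> exceeds the colors of all other items on the path.\<close>
  have rainbow: "total_rainbow c' p" if p: "path_between S E u p v" "total_rainbow c p" for u p v
  proof (rule total_rainbow_transfer[OF p(2)])
    let ?A = "Inr ` set (path_edges p) \<union> Inl ` set (internal_vertices p)"
    assume inj: "inj_on c ?A"
    have "c' y = c y \<and> c' y < k" if "y \<in> ?A - {Inl w}" for y
    proof -
      have "set (path_edges p) \<subseteq> E" "set (internal_vertices p) \<subseteq> S"
        using p(1) internal_vertices_subset[of p] by (auto simp: path_between_def)
      then show ?thesis using that c'_old c'_E by blast
    qed
    then show "inj_on c' ?A"
      using inj c'_w unfolding inj_on_def by (metis DiffI less_irrefl singletonD)
  qed
  have "total_rainbow_connected ?V ?E c'"
  proof (rule total_rainbow_connected_symI)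
    have base: "\<exists>p. path_between ?V ?E u p v \<and> total_rainbow c' p"
      if "u \<in> ?V" "v \<in> S" "u \<noteq> v" for u v
    proof (cases "u \<in> S")
      case True
      then obtain p where "path_between S E u p v" "total_rainbow c p"
        using c(1) \<open>v \<in> S\<close> \<open>u \<noteq> v\<close> unfolding total_rainbow_connected_def by blast
      then show ?thesis using rainbow path_between_mono[of S E u p v ?V ?E] by blast
    next
      case False
      then have u: "u \<in> X" using that by blast
      show ?thesis
      proof (cases "v = w")
        case True
        have "path_between ?V ?E u [u, w] w"
          by (rule path_between_edge) (use u w False in \<open>auto simp: insert_commute\<close>)
        then show ?thesis unfolding True using total_rainbow_edge by (intro exI conjI)
      next
        case vw: False
        then obtain q where q: "path_between S E w q v" "total_rainbow c q"
          using c(1) \<open>v \<in> S\<close> w unfolding total_rainbow_connected_def by metis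
        then obtain q' where q': "q = w # q'" "q' \<noteq> []"
          using vw by (cases q) (auto simp: path_between_def split: if_splits)
        have sub: "set (path_edges q) \<subseteq> E" "set (internal_vertices q) \<subseteq> S - {w}"
          using q(1) q' by (auto simp: path_between_def internal_vertices_def dest: in_set_butlastD)
        have small: "y < k"
          if "y \<in> c' ` (Inr ` set (path_edges q) \<union> Inl ` set (internal_vertices q))" for y
          using that sub c'_old c'_E by blast
        have "path_between ?V ?E u (u # q) v"
          using q(1) q' u False by (auto simp: path_between_def path_edges_Cons insert_commute)
        moreover have "total_rainbow c' (u # q)"
          unfolding total_rainbow_Cons[OF q(1) vw]
          using rainbow[OF q] small c'_w c'_P[OF u] by (fastforce simp: insert_commute)
        ultimately show ?thesis by blast
      qed
    qed
    fix u v assume uv: "u \<in> ?V" "v \<in> ?V" "u \<noteq> v"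
    show "\<exists>p. (path_between ?V ?E u p v \<or> path_between ?V ?E v p u) \<and> total_rainbow c' p"
    proof (cases "u \<in> S \<or> v \<in> S")
      case True
      then show ?thesis using base uv by metis
    next
      case False
      then have "u \<in> X" "v \<in> X" using uv by auto
      moreover have "g {w, u} \<noteq> g {w, v}"
        using g uv \<open>u \<in> X\<close> \<open>v \<in> X\<close> by (auto simp: bij_betw_def inj_on_def doubleton_eq_iff)
      ultimately have "path_between ?V ?E u [u, w, v] v" "total_rainbow c' [u, w, v]"
        using w uv False c'_w c'_P[of u] c'_P[of v]
        by (auto simp: path_between_def total_rainbow_two_edges insert_commute)
      then show ?thesis by blast
    qed
  qed
  moreover have "c' y < k + card X + 1" for y
  proof (cases y)
    case (Inl x)
    then show ?thesis using c(2)[of x] by (cases "x \<in> S - {w}") (auto simp: c'_def)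
  next
    case (Inr e)
    then show ?thesis using c(3)[of e] g_less[of e]
      by (cases "e \<in> E"; cases "e \<in> ?P") (auto simp: c'_def)
  qed
  moreover have "c' (Inl x) \<noteq> c' (Inr e)" if e: "e \<in> ?E" "x \<in> e" for e x
  proof (cases "e \<in> E")
    case True
    then have "x \<in> S" using E e(2) by blast
    then show ?thesis using True c'_E[OF True] c'_w c'_old[of x] c(4)[OF True e(2)]
      by (cases "x = w") auto
  next
    case False
    then obtain z where z: "z \<in> X" "e = {w, z}" using e by blast
    then have "c' (Inl x) = k" using e X(2) c'_w by (auto simp: c'_def)
    then show ?thesis using c'_P z by simp
  qed
  ultimately show ?thesis unfolding colorable_def by blast
qed

lemma colorable_star:
  assumes "finite X" "w \<notin> X"
  shows "colorable (insert w X) ((\<lambda>x. {w, x}) ` X) (card X + 1)"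
proof -
  have "total_rainbow_connected {w} {} (\<lambda>_. 0)" by (simp add: total_rainbow_connected_def)
  from colorable_add_pendants[OF this, of w 0 X] assms show ?thesis by simp
qed

text \<open>A vertex adjacent to the part colored so far is added as a pendant at the cost of two
  colors, one for its edge and one for the recolored neighbor. The other induced edges come for free
  by \<open>colorable_supergraph\<close>.\<close>

lemma colorable_grow:
  assumes "finite V" "connected_graph V E" "\<And>e. e \<in> E \<Longrightarrow> card e = 2"
    and "S \<subseteq> V" "S \<noteq> {}" "colorable S (E \<inter> Pow S) k"
  shows "colorable V (E \<inter> Pow V) (k + 2 * card (V - S))"
  using assms(4-)
proof (induction "card (V - S)" arbitrary: S k)
  case 0
  then have "V = S" using assms(1) by auto
  then show ?case using 0 by simp
next
  case (Suc n)
  then obtain w x where wx: "w \<in> S" "x \<in> V" "x \<notin> S" "{w, x} \<in> E"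
    using connected_graph_cut[OF assms(2), of _ S]
    by (metis Diff_eq_empty_iff all_not_in_conv card.empty nat.distinct(1) subsetI)
  obtain c where c: "total_rainbow_connected S (E \<inter> Pow S) c" "\<And>y. c y < k"
    "\<And>e x. e \<in> E \<inter> Pow S \<Longrightarrow> x \<in> e \<Longrightarrow> c (Inl x) \<noteq> c (Inr e)"
    using Suc.prems(3) unfolding colorable_def by blast
  \<comment> \<open>A strict bound on values is positive, so \<open>k + 2\<close> supplies the three
    colors needed for the extra edges.\<close>
  have k: "0 < k" using c(2)[of undefined] by simp
  have "colorable (S \<union> {x}) (E \<inter> Pow S \<union> (\<lambda>x. {w, x}) ` {x}) (k + card {x} + 1)"
    by (rule colorable_add_pendants[OF c(1)]) (use c wx in auto)
  then have "colorable (insert x S) (insert {w, x} (E \<inter> Pow S)) (k + 2)" by simp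
  then have "colorable (insert x S) (E \<inter> Pow (insert x S)) (k + 2)"
    by (rule colorable_supergraph) (use wx assms(3) k in auto)
  moreover have "card (V - insert x S) = n"
    using Suc.hyps(2) wx assms(1) by (metis Diff_insert Diff_iff card_Diff_singleton diff_Suc_1)
  ultimately have "colorable V (E \<inter> Pow V) (k + 2 + 2 * card (V - insert x S))"
    using Suc.hyps(1)[of "insert x S"] Suc.prems(1) wx(2) by blast
  then show ?case using \<open>card (V - insert x S) = n\<close> by (simp flip: Suc.hyps(2))
qed

text \<open>The star at \<open>w\<close> takes \<open>card X + 1\<close> colors on as many vertices,
  and each of the \<open>card V - card X - 1\<close> others costs two. With
  \<open>2 \<le> card X\<close> there are three colors for the edges between leaves.\<close>

lemma colorable_degree:
  assumes "finite V" "connected_graph V E" "\<And>e. e \<in> E \<Longrightarrow> e \<subseteq> V \<and> card e = 2"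
    and "\<And>x. x \<in> X \<Longrightarrow> {w, x} \<in> E" "2 \<le> card X"
  shows "colorable V E (2 * card V - 1 - card X)"
proof -
  have fin: "finite X" using assms(5) by (metis card.infinite not_numeral_le_zero)
  have w: "w \<notin> X" using assms(3,4) by fastforce
  obtain x where "x \<in> X" using assms(5) by fastforce
  then have sub: "insert w X \<subseteq> V" using assms(3,4) by blast
  have "colorable (insert w X) (E \<inter> Pow (insert w X)) (card X + 1)"
    by (rule colorable_supergraph[OF colorable_star[OF fin w]]) (use assms in auto)
  then have "colorable V (E \<inter> Pow V) (card X + 1 + 2 * card (V - insert w X))"
    using colorable_grow[OF assms(1,2) _ sub] assms(3) by blast
  moreover have "E \<inter> Pow V = E" using assms(3) by blast
  moreover have "card X + 1 + 2 * card (V - insert w X) = 2 * card V - 1 - card X"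
    using card_Diff_subset[OF _ sub] card_mono[OF assms(1) sub] fin w by simp
  ultimately show ?thesis by simp
qed

subsection \<open>Extending a coloring by one vertex\<close>

text \<open>A non-neighbor \<open>x\<close> of \<open>v\<close> is reached by the path
  \<open>v\<close>, \<open>m x\<close>, \<open>x\<close>, and old vertices keep their paths. The
  edge from \<open>v\<close> to a middle vertex \<open>y\<close> must avoid the color of
  \<open>y\<close> and those of the edges from \<open>y\<close> to its fibre under \<open>m\<close>;
  the fibre bound leaves a color for it.\<close>

lemma colorable_extend:
  assumes "colorable S {e \<in> E. v \<notin> e} k" "finite S" "v \<notin> S"
    and E: "\<And>e. e \<in> E \<Longrightarrow> e \<subseteq> insert v S \<and> card e = 2"
    and N: "N = {x \<in> S. {v, x} \<notin> E}"
    and m: "\<And>x. x \<in> N \<Longrightarrow> m x \<in> S \<and> {v, m x} \<in> E \<and> {m x, x} \<in> E"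
    and k: "3 \<le> k" "card N < k" "\<And>y. card {x \<in> N. m x = y} + 2 \<le> k"
  shows "colorable (insert v S) E k"
proof -
  let ?E' = "{e \<in> E. v \<notin> e}"
  obtain c where c: "total_rainbow_connected S ?E' c" "\<And>y. c y < k"
    "\<And>e x. e \<in> ?E' \<Longrightarrow> x \<in> e \<Longrightarrow> c (Inl x) \<noteq> c (Inr e)"
    using assms(1) unfolding colorable_def by blast
  have fN: "finite N" using N assms(2) by simp
  define B where "B y = insert (c (Inl y)) ((\<lambda>x. c (Inr {y, x})) ` {x \<in> N. m x = y})" for y
  have "\<exists>a<k. a \<notin> B y" for y
  proof (rule ex_color_avoiding)
    show "finite (B y)" using fN by (simp add: B_def)
    have "card (B y) \<le> Suc (card ((\<lambda>x. c (Inr {y, x})) ` {x \<in> N. m x = y}))"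
      unfolding B_def by (rule card_insert_le_m1) simp_all
    also have "\<dots> \<le> Suc (card {x \<in> N. m x = y})"
      using card_image_le[of "{x \<in> N. m x = y}" "\<lambda>x. c (Inr {y, x})"] fN by simp
    finally show "card (B y) < k" using k(3)[of y] by simp
  qed
  then obtain t where t: "\<And>y. t y < k" "\<And>y. t y \<notin> B y" by metis
  \<comment> \<open>At most \<open>card N\<close> edges at \<open>v\<close> end in middle vertices,
    so some color \<open>a\<close> for \<open>v\<close> differs from all of theirs.\<close>
  have "card (t ` m ` N) < k"
    using card_image_le[of N m] card_image_le[of "m ` N" t] fN k(2) by simp
  then obtain a where a: "a < k" "a \<notin> t ` m ` N"
    using ex_color_avoiding[of "t ` m ` N" k] fN by blast
  \<comment> \<open>Edges from \<open>v\<close> to its remaining neighbors avoid only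
    \<open>a\<close> and the color of the other end, which three colors allow.\<close>
  have "\<exists>b<k. b \<notin> {a, c (Inl y)}" for y
    by (rule ex_color_avoiding) (use k(1) card_insert_le_m1[of 2 "{c (Inl y)}" a] in auto)
  then obtain h where h: "\<And>y. h y < k" "\<And>y. h y \<noteq> a" "\<And>y. h y \<noteq> c (Inl y)"
    by (metis insertI1 insertI2)
  define s where "s y = (if y \<in> m ` N then t y else h y)" for y
  have s: "s y < k" "s y \<noteq> a" "s y \<noteq> c (Inl y)" for y
    using t[of y] a h[of y] by (auto simp: s_def B_def)
  have s_edge: "s (m x) \<noteq> c (Inr {m x, x})" if "x \<in> N" for x
    using that t(2)[of "m x"] by (auto simp: s_def B_def)
  \<comment> \<open>The other end of an edge \<open>e\<close> at \<open>v\<close> is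
    \<open>the_elem (e - {v})\<close>.\<close>
  define c' where "c' z = (case z of Inl x \<Rightarrow> if x = v then a else c (Inl x)
      | Inr e \<Rightarrow> if v \<in> e then s (the_elem (e - {v})) else c (Inr e))" for z
  have c'_v: "c' (Inr {v, y}) = s y" if "y \<in> S" for y
  proof -
    have "{v, y} - {v} = {y}" using that assms(3) by auto
    then show ?thesis by (simp add: c'_def)
  qed
  have c'_old: "c' (Inl x) = c (Inl x)" if "x \<in> S" for x
    using that assms(3) by (auto simp: c'_def)
  have c'_E: "c' (Inr e) = c (Inr e)" if "v \<notin> e" for e
    using that by (simp add: c'_def)
  let ?V = "insert v S"
  have "total_rainbow_connected ?V E c'"
  proof (rule total_rainbow_connected_symI)
    have new: "\<exists>p. path_between ?V E v p x \<and> total_rainbow c' p" if x: "x \<in> S" for x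
    proof (cases "{v, x} \<in> E")
      case True
      have "path_between ?V E v [v, x] x"
        by (rule path_between_edge) (use True x assms(3) in auto)
      then show ?thesis using total_rainbow_edge by (intro exI conjI)
    next
      case False
      then have xN: "x \<in> N" using x N by simp
      note mx = m[OF xN]
      have neq: "m x \<noteq> x" using E[of "{m x, x}"] mx by auto
      have "path_between ?V E v [v, m x, x] x"
        using mx x neq assms(3) by (auto simp: path_between_def)
      moreover have "v \<notin> {m x, x}" using mx x assms(3) by auto
      then have "total_rainbow c' [v, m x, x]"
        using c'_v[of "m x"] c'_old[of "m x"] c'_E[of "{m x, x}"] mx s[of "m x"] s_edge[OF xN]
          c(3)[of "{m x, x}" "m x"]
        by (simp add: total_rainbow_two_edges)
      ultimately show ?thesis by blast
    qed
    fix u w assume uw: "u \<in> ?V" "w \<in> ?V" "u \<noteq> w"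
    show "\<exists>p. (path_between ?V E u p w \<or> path_between ?V E w p u) \<and> total_rainbow c' p"
    proof (cases "u = v \<or> w = v")
      case True
      then show ?thesis using new uw by (metis insertE)
    next
      case False
      then have "u \<in> S" "w \<in> S" using uw by auto
      then obtain p where p: "path_between S ?E' u p w" "total_rainbow c p"
        using c(1) uw(3) unfolding total_rainbow_connected_def by blast
      have "set (path_edges p) \<subseteq> ?E'" "set (internal_vertices p) \<subseteq> S"
        using p(1) internal_vertices_subset[of p] by (auto simp: path_between_def)
      then have "total_rainbow c' p"
        by (intro total_rainbow_cong[OF p(2)] c'_E c'_old) auto
      moreover have "path_between ?V E u p w"
        by (rule path_between_mono[OF p(1)]) auto
      ultimately show ?thesis by blast
    qed
  qed
  moreover have "c' z < k" for z
    using c(2) s(1) a(1) by (simp add: c'_def split: sum.split)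
  moreover have "c' (Inl x) \<noteq> c' (Inr e)" if e: "e \<in> E" "x \<in> e" for e x
  proof (cases "v \<in> e")
    case True
    then obtain y where y: "e = {v, y}" "y \<in> S"
      using E[OF e(1)] assms(3) unfolding card_2_iff by blast
    then show ?thesis
      using e(2) c'_v[OF y(2)] s[of y] c'_old[OF y(2)] by (auto simp: c'_def)
  next
    case False
    moreover have "x \<in> S" using E[OF e(1)] e False by blast
    ultimately show ?thesis using c(3)[of e x] c'_old c'_E e by simp
  qed
  ultimately show ?thesis unfolding colorable_def by blast
qed

section \<open>Complementary pairs and the induction step\<close>

definition complementary :: "'a set \<Rightarrow> 'a set set \<Rightarrow> 'a set set \<Rightarrow> bool" where
  "complementary V E F \<longleftrightarrow> finite V \<and> E \<union> F = {e. e \<subseteq> V \<and> card e = 2} \<and> E \<inter> F = {} \<and>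
     connected_graph V E \<and> connected_graph V F"

definition sum_colorable :: "'a set \<Rightarrow> 'a set set \<Rightarrow> 'a set set \<Rightarrow> nat \<Rightarrow> bool" where
  "sum_colorable V E F s \<longleftrightarrow> (\<exists>k l. colorable V E k \<and> colorable V F l \<and> k + l \<le> s)"

lemma complementary_sym: "complementary V E F \<Longrightarrow> complementary V F E"
  by (auto simp: complementary_def)

lemma sum_colorable_sym: "sum_colorable V E F s \<Longrightarrow> sum_colorable V F E s"
  unfolding sum_colorable_def by (metis add.commute)

lemma sum_colorableI: "colorable V E k \<Longrightarrow> colorable V F l \<Longrightarrow> k + l \<le> s \<Longrightarrow> sum_colorable V E F s"
  unfolding sum_colorable_def by blast

lemma complementaryD:
  assumes "complementary V E F"
  shows "finite V" "connected_graph V E" "connected_graph V F"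
    and "\<And>e. e \<in> E \<Longrightarrow> e \<subseteq> V \<and> card e = 2" "\<And>e. e \<in> F \<Longrightarrow> e \<subseteq> V \<and> card e = 2"
    and "\<And>x y. x \<in> V \<Longrightarrow> y \<in> V \<Longrightarrow> x \<noteq> y \<Longrightarrow> {x, y} \<in> F \<longleftrightarrow> {x, y} \<notin> E"
proof -
  have *: "E \<union> F = {e. e \<subseteq> V \<and> card e = 2}" "E \<inter> F = {}"
    using assms by (auto simp: complementary_def)
  show "finite V" "connected_graph V E" "connected_graph V F"
    using assms by (auto simp: complementary_def)
  show "e \<subseteq> V \<and> card e = 2" if "e \<in> E" for e using * that by blast
  show "e \<subseteq> V \<and> card e = 2" if "e \<in> F" for e using * that by blast
  show "{x, y} \<in> F \<longleftrightarrow> {x, y} \<notin> E" if "x \<in> V" "y \<in> V" "x \<noteq> y" for x y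
  proof -
    have "{x, y} \<in> E \<union> F" unfolding *(1) using that by simp
    then show ?thesis using *(2) by blast
  qed
qed

lemma complementary_delete:
  assumes "complementary V E F" "connected_graph (V - {v}) {e \<in> E. v \<notin> e}"
    "connected_graph (V - {v}) {e \<in> F. v \<notin> e}"
  shows "complementary (V - {v}) {e \<in> E. v \<notin> e} {e \<in> F. v \<notin> e}"
proof -
  have "E \<union> F = {e. e \<subseteq> V \<and> card e = 2}" using assms(1) by (simp add: complementary_def)
  then have "{e \<in> E. v \<notin> e} \<union> {e \<in> F. v \<notin> e} = {e. e \<subseteq> V - {v} \<and> card e = 2}" by blast
  then show ?thesis using assms unfolding complementary_def by blast
qed

text \<open>If \<open>F\<close> without \<open>v\<close> was given at least three and more than
  \<open>card N\<close> colors, they also suffice for \<open>F\<close>, and \<open>E\<close> gets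
  two new ones. Otherwise \<open>F\<close> is colored with \<open>max 3 (card N + 1)\<close> colors,
  and \<open>E\<close> is colored from a star with at least \<open>card N\<close> leaves.\<close>

lemma sum_colorable_step:
  assumes C: "complementary V E F" and v: "v \<in> V" and V: "3 \<le> card V"
    and IH: "sum_colorable (V - {v}) {e \<in> E. v \<notin> e} {e \<in> F. v \<notin> e} (2 * (card V - 1))"
    and conn: "connected_graph (V - {v}) {e \<in> E. v \<notin> e}"
    and N: "N = {x \<in> V. {v, x} \<in> E}"
    and m: "\<And>x. x \<in> N \<Longrightarrow> m x \<in> V \<and> {v, m x} \<in> F \<and> {m x, x} \<in> F"
    and fib: "card N = 1 \<or> (\<forall>y. card {x \<in> N. m x = y} < card N)"
  shows "sum_colorable V E F (2 * card V)"
proof -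
  note D = complementaryD[OF C]
  obtain k l where kl: "colorable (V - {v}) {e \<in> E. v \<notin> e} k"
    "colorable (V - {v}) {e \<in> F. v \<notin> e} l" "k + l \<le> 2 * (card V - 1)"
    using IH unfolding sum_colorable_def by blast
  have fN: "finite N" using N D(1) by simp
  have insV: "insert v (V - {v}) = V" using v by blast
  have vF: "{v} \<notin> F" "{v} \<notin> E" using D(4)[of "{v}"] D(5)[of "{v}"] by auto
  have "{v, x} \<in> E \<longleftrightarrow> x \<noteq> v \<and> {v, x} \<notin> F" if "x \<in> V" for x
    using that v vF D(6)[of v x] by (cases "x = v") auto
  then have N': "N = {x \<in> V - {v}. {v, x} \<notin> F}" using N by blast
  have small: "card {x \<in> N. m x = y} \<le> card N" for y
    using fN by (simp add: card_mono)
  \<comment> \<open>If no fibre is all of \<open>N\<close>, its size plus two is at most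
    \<open>card N + 1\<close>, hence at most \<open>j\<close>; for \<open>card N = 1\<close> the
    bound \<open>3 \<le> j\<close> does the same.\<close>
  have F: "colorable V F j" if "colorable (V - {v}) {e \<in> F. v \<notin> e} j" "3 \<le> j" "card N < j" for j
  proof -
    have "colorable (insert v (V - {v})) F j"
    proof (rule colorable_extend[OF that(1) _ _ _ N' _ that(2,3)])
      fix x assume "x \<in> N"
      from m[OF this] vF show "m x \<in> V - {v} \<and> {v, m x} \<in> F \<and> {m x, x} \<in> F" by auto
    next
      fix y
      show "card {x \<in> N. m x = y} + 2 \<le> j"
      proof (cases "card N = 1")
        case True
        then show ?thesis using small[of y] that by linarith
      next
        case False
        then have "card {x \<in> N. m x = y} < card N" using fib by blast
        then show ?thesis using that by linarith
      qed
    qed (use D insV in auto)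
    then show ?thesis using insV by simp
  qed
  show ?thesis
  proof (cases "3 \<le> l \<and> card N < l")
    case True
    have "{e \<in> E. v \<notin> e} = E \<inter> Pow (V - {v})" using D(4) by blast
    then have "colorable V (E \<inter> Pow V) (k + 2 * card (V - (V - {v})))"
      using colorable_grow[OF D(1,2), of "V - {v}" k] kl(1) D(4) conn
      by (auto simp: connected_graph_def)
    moreover have "E \<inter> Pow V = E" using D(4) by blast
    moreover have "V - (V - {v}) = {v}" using v by blast
    ultimately have "colorable V E (k + 2)" by simp
    then show ?thesis using F[OF kl(2)] True kl(3) V by (intro sum_colorableI) auto
  next
    case False
    define j where "j = max 3 (card N + 1)"
    have "colorable V F j"
      by (rule F[OF colorable_le[OF kl(2)]]) (use False in \<open>auto simp: j_def\<close>)
    \<comment> \<open>The star is at \<open>v\<close> when \<open>card N\<close> is at least two.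
      Otherwise any vertex of degree at least two will do, and a connected graph on three or more
      vertices has one.\<close>
    moreover have "\<exists>X w. 2 \<le> card X \<and> card N \<le> card X \<and> (\<forall>x\<in>X. {w, x} \<in> E)"
    proof (cases "2 \<le> card N")
      case True
      then show ?thesis using N by blast
    next
      case False
      have "N \<noteq> {}"
      proof -
        have "\<not> V \<subseteq> {v}" using V card_mono[of "{v}" V] by auto
        then obtain z where "z \<in> V" "z \<notin> {v}" by blast
        then show ?thesis
          using connected_graph_cut[OF D(2), of v "{v}" z] v N by blast
      qed
      then obtain w where w: "w \<in> V" "{v, w} \<in> E" using N by blast
      have "card {v, w} \<le> 2" by (simp add: card_insert_if)
      then have "\<not> V \<subseteq> {v, w}" using V card_mono[of "{v, w}" V] by auto
      then obtain z where z: "z \<in> V" "z \<notin> {v, w}" by blast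
      obtain x y where xy: "x \<in> {v, w}" "y \<in> V" "y \<notin> {v, w}" "{x, y} \<in> E"
        using connected_graph_cut[OF D(2), of v "{v, w}" z] v w z by auto
      \<comment> \<open>Here \<open>x\<close> is the end of \<open>{v, w}\<close> with a further
        neighbor \<open>y\<close>; the leaves are \<open>y\<close> and the other end.\<close>
      let ?X = "({v, w} - {x}) \<union> {y}"
      have "v \<noteq> w" using w vF by auto
      then have "card ?X = 2" "\<forall>t\<in>?X. {x, t} \<in> E" using xy w by (auto simp: insert_commute)
      then show ?thesis using False by (intro exI[of _ ?X] exI[of _ x]) auto
    qed
    then obtain X w where X: "2 \<le> card X" "card N \<le> card X" "\<And>x. x \<in> X \<Longrightarrow> {w, x} \<in> E" by blast
    then have "colorable V E (2 * card V - 1 - card X)"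
      using colorable_degree[OF D(1,2,4)] by blast
    moreover have "X \<subseteq> V - {w}" using X(3) D(4) by fastforce
    then have "card X \<le> card V" using D(1) by (meson card_mono Diff_subset subset_trans)
    \<comment> \<open>The sum is \<open>j + 2 * card V - 1 - card X\<close>, and
      \<open>j \<le> card X + 1\<close>.\<close>
    ultimately show ?thesis using X V by (intro sum_colorableI) (auto simp: j_def)
  qed
qed

subsection \<open>Reducible vertices\<close>

lemma connected_graph_restrict:
  assumes "v \<notin> S"
  shows "connected_graph S {e \<in> E. v \<notin> e} \<longleftrightarrow> connected_graph S E"
proof -
  have "{x, y} \<in> {e \<in> E. v \<notin> e} \<longleftrightarrow> {x, y} \<in> E" if "x \<in> T" "y \<in> S - T" "T \<subseteq> S" for x y T
    using that assms by auto
  then show ?thesis unfolding connected_graph_iff_cut by (meson subset_iff)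
qed

lemma connected_graph_join:
  assumes "A \<noteq> {}" "B \<noteq> {}" "\<And>a b. a \<in> A \<Longrightarrow> b \<in> B \<Longrightarrow> {a, b} \<in> E"
  shows "connected_graph (A \<union> B) E"
proof -
  obtain a b where ab: "a \<in> A" "b \<in> B" using assms by blast
  show ?thesis
  proof (rule connected_graph_rankI[of a _ _ "\<lambda>x. if x = a then 0 else if x \<in> B then 1 else 2"])
    fix u assume u: "u \<in> A \<union> B" "u \<noteq> a"
    show "\<exists>u'\<in>A \<union> B. {u, u'} \<in> E \<and> (if u' = a then 0 else if u' \<in> B then 1 else 2)
        < (if u = a then 0 else if u \<in> B then 1 else (2::nat))"
    proof (cases "u \<in> B")
      case True
      then show ?thesis using u ab assms(3)[of a u]
        by (intro bexI[of _ a]) (auto simp: insert_commute)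
    next
      case False
      then show ?thesis using u ab assms(3)[of u b] by (intro bexI[of _ b]) auto
    qed
  qed (use ab in blast)
qed

text \<open>A maximal connected proper subset \<open>S\<close> misses only one vertex: adding a
  vertex \<open>y\<close> adjacent to \<open>S\<close> keeps it connected, so by maximality gives
  all of \<open>V\<close>.\<close>

lemma exists_noncut_vertex:
  assumes "finite V" "connected_graph V E" "2 \<le> card V"
  shows "\<exists>y\<in>V. connected_graph (V - {y}) E"
proof -
  define C where "C = {S. S \<subset> V \<and> connected_graph S E}"
  obtain x where x: "x \<in> V" using assms(3) by fastforce
  have "V \<noteq> {x}" using assms(3) by auto
  then have "{x} \<in> C" using x by (auto simp: C_def connected_graph_iff_cut)
  moreover have "finite C"
    unfolding C_def using assms(1) by (auto intro: finite_subset[of _ "Pow V"])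
  ultimately have "\<exists>S\<in>C. \<forall>T\<in>C. S \<subseteq> T \<longrightarrow> S = T"
    by (intro finite_has_maximal) blast+
  then obtain S where SC: "S \<in> C" and max: "\<And>T. T \<in> C \<Longrightarrow> S \<subseteq> T \<Longrightarrow> S = T"
    by blast
  have S: "S \<subset> V" "connected_graph S E" using SC by (auto simp: C_def)
  then obtain z where "z \<in> V" "z \<notin> S" by blast
  moreover obtain s where "s \<in> S" using S(2) by (auto simp: connected_graph_def)
  ultimately obtain a y where y: "a \<in> S" "y \<in> V" "y \<notin> S" "{a, y} \<in> E"
    using connected_graph_cut[OF assms(2), of s S z] S(1) by blast
  have "connected_graph (insert y S) E"
    by (rule connected_graph_insert[OF S(2) y(1,4) subset_refl])
  then have "insert y S = V" using max[of "insert y S"] S(1) y unfolding C_def by blast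
  then have "V - {y} = S" using y by blast
  then show ?thesis using S(2) y(2) by auto
qed

text \<open>A cut vertex \<open>v\<close> of \<open>E\<close> splits the rest into \<open>S\<close>
  and \<open>T\<close> without \<open>E\<close>-edges between them, so \<open>F\<close> has all
  edges between \<open>S\<close> and \<open>T\<close>. Deleting \<open>w\<close> can then disconnect
  \<open>F\<close> only if \<open>w\<close> is the sole \<open>F\<close>-neighbor of
  \<open>v\<close>, or forms one side alone and leaves the other side disconnected; at most one
  vertex is of each kind.\<close>

lemma cut_vertices_complement:
  assumes C: "complementary V E F" and v: "v \<in> V" "\<not> connected_graph (V - {v}) E"
    and V: "2 \<le> card V"
  shows "card {w \<in> V. \<not> connected_graph (V - {w}) F} \<le> 2"
proof -
  note D = complementaryD[OF C]
  have "\<not> V \<subseteq> {v}" using V card_mono[of "{v}" V] by auto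
  then obtain S where S: "S \<subseteq> V - {v}" "S \<noteq> {}" "S \<noteq> V - {v}"
    "\<And>x y. x \<in> S \<Longrightarrow> y \<in> V - {v} - S \<Longrightarrow> {x, y} \<notin> E"
    using v(2) unfolding connected_graph_iff_cut by blast
  define T where "T = V - {v} - S"
  have T: "T \<noteq> {}" "S \<union> T = V - {v}" using S by (auto simp: T_def)
  have ST: "{x, y} \<in> F" if "x \<in> S" "y \<in> T" for x y
    using that S D(6)[of x y] by (auto simp: T_def)
  have vF: "connected_graph (V - {v}) F"
    using connected_graph_join[of S T F] S(2) T ST by simp
  \<comment> \<open>Within \<open>V\<close>, \<open>?L\<close> has at most the sole neighbor of
    \<open>v\<close>; \<open>?D\<close> has the vertices that dominate \<open>F\<close> without
    \<open>v\<close> and separate it.\<close>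
  let ?L = "{w. \<forall>u\<in>V. {v, u} \<in> F \<longrightarrow> u = w}"
  let ?D = "{w \<in> V - {v}. (\<forall>u\<in>V - {v, w}. {w, u} \<in> F) \<and> \<not> connected_graph (V - {v, w}) F}"
  have "w \<in> ?L \<union> ?D" if w: "w \<in> V" "\<not> connected_graph (V - {w}) F" for w
  proof (cases "w \<in> ?L")
    case False
    then obtain u where u: "u \<in> V" "{v, u} \<in> F" "u \<noteq> w" by blast
    have "v \<noteq> w" using w vF by blast
    have "u \<noteq> v" using u D(5)[of "{v, u}"] by auto
    have nc: "\<not> connected_graph (V - {v, w}) F"
    proof
      assume "connected_graph (V - {v, w}) F"
      then have "connected_graph (insert v (V - {v, w})) F"
        by (rule connected_graph_insert[of _ _ u])
          (use u \<open>u \<noteq> v\<close> in \<open>auto simp: insert_commute\<close>)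
      moreover have "insert v (V - {v, w}) = V - {w}" using v \<open>v \<noteq> w\<close> by blast
      ultimately show False using w by simp
    qed
    have "S - {w} = {} \<or> T - {w} = {}"
    proof (rule ccontr)
      assume "\<not> ?thesis"
      then have "connected_graph ((S - {w}) \<union> (T - {w})) F"
        using connected_graph_join[of "S - {w}" "T - {w}" F] ST by blast
      moreover have "(S - {w}) \<union> (T - {w}) = V - {v, w}" using T by blast
      ultimately show False using nc by simp
    qed
    then have "S = {w} \<or> T = {w}" using S T by blast
    then have "\<forall>u\<in>V - {v, w}. {w, u} \<in> F"
    proof
      assume "S = {w}"
      then show ?thesis using ST T by blast
    next
      assume "T = {w}"
      then have "\<forall>u\<in>V - {v, w}. {u, w} \<in> F" using ST T by blast
      then show ?thesis by (simp add: insert_commute)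
    qed
    then show ?thesis using nc w \<open>v \<noteq> w\<close> by blast
  qed blast
  then have sub: "{w \<in> V. \<not> connected_graph (V - {w}) F} \<subseteq> (?L \<inter> V) \<union> ?D" by blast
  have finL: "finite (?L \<inter> V)" and finD: "finite ?D" using D(1) by auto
  have "card (?L \<inter> V) \<le> Suc 0"
  proof -
    obtain z where "z \<in> V" "z \<notin> {v}" using \<open>\<not> V \<subseteq> {v}\<close> by blast
    then obtain u where "u \<in> V" "{v, u} \<in> F"
      using connected_graph_cut[OF D(3), of v "{v}" z] v by blast
    then show ?thesis using finL by (auto simp: card_le_Suc0_iff_eq)
  qed
  moreover have "card ?D \<le> Suc 0"
  proof -
    have "w = w'" if w: "w \<in> ?D" "w' \<in> ?D" for w w'
    proof (rule ccontr)
      assume "w \<noteq> w'"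
      \<comment> \<open>A second such vertex \<open>w'\<close> is adjacent to everything left after
        deleting \<open>w\<close>, and so connects it.\<close>
      have "connected_graph (V - {v, w}) F"
      proof (rule connected_graph_rankI[of w' _ _ "\<lambda>x. if x = w' then 0 else 1"])
        fix u assume u: "u \<in> V - {v, w}" "u \<noteq> w'"
        then have "{u, w'} \<in> F" using w by (auto simp: insert_commute)
        then show "\<exists>u'\<in>V - {v, w}. {u, u'} \<in> F \<and>
            (if u' = w' then 0 else 1) < (if u = w' then 0 else (1::nat))"
          using u w \<open>w \<noteq> w'\<close> by (intro bexI[of _ w']) auto
      qed (use w \<open>w \<noteq> w'\<close> in blast)
      then show False using w by blast
    qed
    then show ?thesis unfolding card_le_Suc0_iff_eq[OF finD] by blast
  qed
  moreover have "card {w \<in> V. \<not> connected_graph (V - {w}) F} \<le> card (?L \<inter> V) + card ?D"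
    by (rule order_trans[OF card_mono[OF finite_UnI[OF finL finD] sub] card_Un_le])
  ultimately show ?thesis by linarith
qed

text \<open>Otherwise every vertex cuts \<open>E\<close> or \<open>F\<close>. Each graph has a
  noncut vertex, which must cut the other one; so both have cut vertices, hence each at most two,
  and there are at most four vertices in all.\<close>

lemma exists_common_noncut_vertex:
  assumes C: "complementary V E F" and V: "5 \<le> card V"
  shows "\<exists>v\<in>V. connected_graph (V - {v}) E \<and> connected_graph (V - {v}) F"
proof (rule ccontr)
  assume none: "\<not> ?thesis"
  note D = complementaryD[OF C]
  let ?A = "{w \<in> V. \<not> connected_graph (V - {w}) E}"
  let ?B = "{w \<in> V. \<not> connected_graph (V - {w}) F}"
  have V2: "2 \<le> card V" using V by simp
  have "\<exists>v\<in>V. \<not> connected_graph (V - {v}) E"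
    using exists_noncut_vertex[OF D(1,3) V2] none by blast
  then have "card ?B \<le> 2" using cut_vertices_complement[OF C _ _ V2] by blast
  moreover have "\<exists>v\<in>V. \<not> connected_graph (V - {v}) F"
    using exists_noncut_vertex[OF D(1,2) V2] none by blast
  then have "card ?A \<le> 2"
    using cut_vertices_complement[OF complementary_sym[OF C] _ _ V2] by blast
  moreover have "V \<subseteq> ?A \<union> ?B" using none by blast
  then have "card V \<le> card ?A + card ?B"
    by (intro order_trans[OF card_mono card_Un_le]) (use D(1) in simp_all)
  ultimately show False using V by linarith
qed

text \<open>What \<open>sum_colorable_step\<close> requires of \<open>v\<close>. The roles are not
  symmetric: \<open>F\<close> is the graph in which \<open>v\<close> reaches everything within two
  steps.\<close>

definition reducible :: "'a set \<Rightarrow> 'a set set \<Rightarrow> 'a set set \<Rightarrow> 'a \<Rightarrow> bool" where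
  "reducible V E F v \<longleftrightarrow> v \<in> V \<and> connected_graph (V - {v}) E \<and> connected_graph (V - {v}) F \<and>
     (\<exists>m. (\<forall>x\<in>{x \<in> V. {v, x} \<in> E}. m x \<in> V \<and> {v, m x} \<in> F \<and> {m x, x} \<in> F) \<and>
        (card {x \<in> V. {v, x} \<in> E} = 1 \<or>
          (\<forall>y. card {x \<in> {x \<in> V. {v, x} \<in> E}. m x = y} < card {x \<in> V. {v, x} \<in> E})))"

lemma sum_colorable_reducible:
  assumes "complementary V E F" "reducible V E F v" "3 \<le> card V"
    and "sum_colorable (V - {v}) {e \<in> E. v \<notin> e} {e \<in> F. v \<notin> e} (2 * (card V - 1))"
  shows "sum_colorable V E F (2 * card V)"
proof -
  let ?N = "{x \<in> V. {v, x} \<in> E}"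
  obtain m where m: "\<And>x. x \<in> ?N \<Longrightarrow> m x \<in> V \<and> {v, m x} \<in> F \<and> {m x, x} \<in> F"
    "card ?N = 1 \<or> (\<forall>y. card {x \<in> ?N. m x = y} < card ?N)"
    using assms(2) unfolding reducible_def by blast
  have v: "v \<in> V" "connected_graph (V - {v}) {e \<in> E. v \<notin> e}"
    using assms(2) by (auto simp: reducible_def connected_graph_restrict)
  show ?thesis
    by (rule sum_colorable_step[OF assms(1) v(1) assms(3,4) v(2) refl m])
qed

lemma card_fibre_less:
  assumes "finite N" "a \<in> N" "b \<in> N" "m a \<noteq> m b"
  shows "card {x \<in> N. m x = y} < card N"
proof (rule psubset_card_mono[OF assms(1)])
  have "a \<notin> {x \<in> N. m x = y} \<or> b \<notin> {x \<in> N. m x = y}" using assms(4) by auto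
  then show "{x \<in> N. m x = y} \<subset> N" using assms(2,3) by blast
qed

text \<open>If \<open>v\<close> has one \<open>E\<close>-neighbor, or two that can use different
  middle vertices, \<open>v\<close> itself is reducible. Otherwise a single vertex \<open>w\<close>
  serves all of \<open>N\<close>, so \<open>E\<close> has all edges between \<open>N\<close> and
  \<open>M - {w}\<close>, and this density makes a vertex \<open>x\<close> of \<open>N\<close>
  reducible for the exchanged pair.\<close>

lemma reducible_if_eccentricity_two:
  assumes C: "complementary V E F" and V: "5 \<le> card V" and v: "v \<in> V"
    and conn: "connected_graph (V - {v}) E" "connected_graph (V - {v}) F"
    and ecc: "\<And>x. x \<in> V \<Longrightarrow> {v, x} \<in> E \<Longrightarrow> \<exists>m\<in>V. {v, m} \<in> F \<and> {m, x} \<in> F"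
  shows "\<exists>v. reducible V E F v \<or> reducible V F E v"
proof -
  note D = complementaryD[OF C]
  have noloop: "{x} \<notin> E" "{x} \<notin> F" for x using D(4)[of "{x}"] D(5)[of "{x}"] by auto
  define N where "N = {x \<in> V. {v, x} \<in> E}"
  have fN: "finite N" using D(1) by (simp add: N_def)
  define M where "M = {x \<in> V. {v, x} \<in> F}"
  have VNM: "x = v \<or> x \<in> N \<or> x \<in> M" if "x \<in> V" for x
    using that v D(6)[of v x] by (auto simp: N_def M_def)
  have NM: "N \<inter> M = {}" "v \<notin> N" "v \<notin> M" "N \<subseteq> V" "M \<subseteq> V"
    using D(6)[of v] v noloop by (auto simp: N_def M_def) (metis insert_absorb2)
  obtain m where m: "\<And>x. x \<in> N \<Longrightarrow> m x \<in> M \<and> {m x, x} \<in> F"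
    using ecc unfolding N_def M_def by (metis (mono_tags, lifting) mem_Collect_eq)
  have red: "reducible V E F v"
    if "\<And>x. x \<in> N \<Longrightarrow> m' x \<in> M \<and> {m' x, x} \<in> F"
      "card N = 1 \<or> (\<forall>y. card {x \<in> N. m' x = y} < card N)" for m'
    unfolding reducible_def N_def[symmetric]
    using that v conn by (intro conjI exI[of _ m']) (auto simp: M_def)
  show ?thesis
  proof (cases "card N = 1")
    case True
    then show ?thesis using red[of m] m by blast
  next
    case card1: False
    have "N \<noteq> {}"
    proof -
      have "\<not> V \<subseteq> {v}" using V card_mono[of "{v}" V] by auto
      then obtain z where "z \<in> V" "z \<notin> {v}" by blast
      then show ?thesis
        using connected_graph_cut[OF D(2), of v "{v}" z] v N_def by blast
    qed
    then obtain x where x: "x \<in> N" by blast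
    then obtain x' where x': "x' \<in> N" "x' \<noteq> x"
      using card1 by (metis is_singletonI' is_singleton_altdef equals0D)
    show ?thesis
    proof (cases "\<exists>a\<in>N. \<exists>b\<in>N. \<exists>p\<in>M. \<exists>q\<in>M. a \<noteq> b \<and> p \<noteq> q \<and> {p, a} \<in> F \<and> {q, b} \<in> F")
      case True
      then obtain a b p q where ab: "a \<in> N" "b \<in> N" "p \<in> M" "q \<in> M" "a \<noteq> b" "p \<noteq> q"
        "{p, a} \<in> F" "{q, b} \<in> F" by blast
      have "reducible V E F v"
      proof (rule red[of "m(a := p, b := q)"])
        show "(m(a := p, b := q)) y \<in> M \<and> {(m(a := p, b := q)) y, y} \<in> F" if "y \<in> N" for y
          using that m[of y] ab by auto
        show "card N = 1 \<or> (\<forall>y. card {x \<in> N. (m(a := p, b := q)) x = y} < card N)"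
          by (intro disjI2 allI card_fibre_less[OF fN ab(1,2)]) (use ab in simp)
      qed
      then show ?thesis by blast
    next
      case False
      \<comment> \<open>Now all of \<open>N\<close> sees the same single vertex \<open>w\<close> of \<open>M\<close>, so deleting \<open>x\<close>
        instead of \<open>v\<close> works with the roles of the two graphs exchanged.\<close>
      define w where "w = m x'"
      have w: "w \<in> M" "{w, x'} \<in> F" using m[OF x'(1)] by (auto simp: w_def)
      have mw: "m y = w" if "y \<in> N" for y
        using False m[OF that] m[OF x'(1)] x' that w_def by metis
      \<comment> \<open>Otherwise \<open>y\<close> with middle vertex \<open>q\<close> and another
        vertex of \<open>N\<close> with middle vertex \<open>w\<close> would fit the previous
        case.\<close>
      have only: "q = w" if "y \<in> N" "q \<in> M" "{q, y} \<in> F" for y q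
        using False that mw m x x' by metis
      have wN: "{w, y} \<in> F" if "y \<in> N" for y using m[OF that] mw[OF that] by simp
      have NE: "{y, q} \<in> E" if "y \<in> N" "q \<in> M" "q \<noteq> w" for y q
        using only[OF that(1,2)] that D(6)[of y q] NM by (auto simp: insert_commute)
      have vN: "{v, y} \<in> E" if "y \<in> N" for y using that by (simp add: N_def)
      have vM: "{v, y} \<in> F" if "y \<in> M" for y using that by (simp add: M_def)
      have wV: "w \<in> V" "w \<noteq> v" "w \<notin> N" using w NM by auto
      have FE: False if "{y, z} \<in> E" "{y, z} \<in> F" for y z
        using that C by (auto simp: complementary_def)
      \<comment> \<open>As \<open>w\<close> is \<open>F\<close>-adjacent to \<open>v\<close> and to
        all of \<open>N\<close>, its \<open>E\<close>-neighbor lies in \<open>M\<close>; it will be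
        the middle vertex from \<open>x\<close> to \<open>w\<close>.\<close>
      obtain w' where w': "w' \<in> V" "w' \<notin> {w}" "{w, w'} \<in> E"
        using connected_graph_cut[OF D(2), of w "{w}" v] wV v by auto
      have "w' \<noteq> v" using w' vM[OF w(1)] FE[of w v] by (auto simp: insert_commute)
      moreover have "w' \<notin> N" using w' wN FE by blast
      ultimately have w'M: "w' \<in> M" using VNM w' by blast
      have xV: "x \<in> V" "x \<noteq> v" "x \<notin> M" using x NM by auto
      \<comment> \<open>In \<open>E\<close>, \<open>x'\<close> is adjacent to \<open>v\<close> and
        to \<open>M - {w}\<close>; the vertex \<open>w\<close> hangs on \<open>w'\<close>, and the
        rest of \<open>N\<close> on \<open>v\<close>.\<close>
      have "connected_graph (V - {x}) E"
      proof (rule connected_graph_rankI[of x' _ _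
            "\<lambda>y. if y = x' then 0 else if y = v \<or> y \<in> M - {w} then 1 else 2"])
        fix u assume u: "u \<in> V - {x}" "u \<noteq> x'"
        consider "u = v" | "u \<in> M" "u \<noteq> w" | "u = w" | "u \<in> N" using u VNM by blast
        then show "\<exists>u'\<in>V - {x}. {u, u'} \<in> E \<and>
           (if u' = x' then 0 else if u' = v \<or> u' \<in> M - {w} then 1 else 2)
           < (if u = x' then 0 else if u = v \<or> u \<in> M - {w} then 1 else (2::nat))"
        proof cases
          case 1
          then show ?thesis using vN[OF x'(1)] x' NM u by (intro bexI[of _ x']) auto
        next
          case 2
          then show ?thesis using NE[OF x'(1), of u] x' NM u
            by (intro bexI[of _ x']) (auto simp: insert_commute)
        next
          case 3
          then show ?thesis using w' w'M xV wV u by (intro bexI[of _ w']) auto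
        next
          case 4
          then show ?thesis using vN[of u] v xV NM u
            by (intro bexI[of _ v]) (auto simp: insert_commute)
        qed
      qed (use x' NM in auto)
      \<comment> \<open>In \<open>F\<close>, \<open>w\<close> is adjacent to \<open>v\<close> and to
        \<open>N\<close>, and the rest of \<open>M\<close> hangs on \<open>v\<close>.\<close>
      moreover have "connected_graph (V - {x}) F"
      proof (rule connected_graph_rankI[of w _ _
            "\<lambda>y. if y = w then 0 else if y \<in> M then 2 else 1"])
        fix u assume u: "u \<in> V - {x}" "u \<noteq> w"
        consider "u = v" | "u \<in> M" | "u \<in> N" using u VNM by blast
        then show "\<exists>u'\<in>V - {x}. {u, u'} \<in> F \<and>
           (if u' = w then 0 else if u' \<in> M then 2 else 1)
           < (if u = w then 0 else if u \<in> M then 2 else (1::nat))"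
        proof cases
          case 1
          then show ?thesis using vM[OF w(1)] w xV wV u by (intro bexI[of _ w]) auto
        next
          case 2
          then show ?thesis using vM[of u] v xV NM u
            by (intro bexI[of _ v]) (auto simp: insert_commute)
        next
          case 3
          then show ?thesis using wN[of u] w xV wV u
            by (intro bexI[of _ w]) (auto simp: insert_commute)
        qed
      qed (use wV xV w in auto)
      moreover have "\<exists>m'. (\<forall>y\<in>{y \<in> V. {x, y} \<in> F}. m' y \<in> V \<and> {x, m' y} \<in> E \<and> {m' y, y} \<in> E) \<and>
        (card {y \<in> V. {x, y} \<in> F} = 1 \<or>
          (\<forall>z. card {y \<in> {y \<in> V. {x, y} \<in> F}. m' y = z} < card {y \<in> V. {x, y} \<in> F}))"
      \<comment> \<open>Besides \<open>w\<close>, all \<open>F\<close>-neighbors of \<open>x\<close>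
        lie in \<open>N\<close> and are thus \<open>E\<close>-adjacent to \<open>v\<close>; so
        \<open>v\<close> is their middle vertex and \<open>w'\<close> that of
        \<open>w\<close>.\<close>
      proof (intro exI[of _ "\<lambda>y. if y = w then w' else v"] conjI ballI)
        let ?N' = "{y \<in> V. {x, y} \<in> F}"
        have other: "y \<in> N" if "y \<in> ?N'" "y \<noteq> w" for y
        proof -
          have "y \<notin> M" using that only[OF x, of y] by (auto simp: insert_commute)
          moreover have "y \<noteq> v" using that vN[OF x] FE by (auto simp: insert_commute)
          ultimately show ?thesis using VNM that by blast
        qed
        fix y assume y: "y \<in> ?N'"
        show "(if y = w then w' else v) \<in> V" using w' v by simp
        show "{x, if y = w then w' else v} \<in> E"
          using NE[OF x w'M] w' vN[OF x] by (auto simp: insert_commute)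
        show "{if y = w then w' else v, y} \<in> E"
          using w' vN[OF other[OF y]] by (auto simp: insert_commute)
      next
        let ?N' = "{y \<in> V. {x, y} \<in> F}"
        have wN': "w \<in> ?N'" using wN[OF x] wV by (simp add: insert_commute)
        have fN': "finite ?N'" using D(1) by simp
        show "card ?N' = 1 \<or>
          (\<forall>z. card {y \<in> ?N'. (if y = w then w' else v) = z} < card ?N')"
        proof (cases "?N' = {w}")
          case True
          then show ?thesis by simp
        next
          case False
          then obtain y where y: "y \<in> ?N'" "y \<noteq> w" using wN' by blast
          show ?thesis
            by (intro disjI2 allI card_fibre_less[OF fN' wN' y(1)]) (use y \<open>w' \<noteq> v\<close> in simp)
        qed
      qed
      ultimately have "reducible V F E x" using xV unfolding reducible_def by blast
      then show ?thesis by blast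
    qed
  qed
qed

text \<open>If an \<open>E\<close>-neighbor \<open>x\<close> of \<open>v\<close> has no common
  \<open>F\<close>-neighbor with \<open>v\<close>, then every \<open>F\<close>-neighbor of
  \<open>v\<close> is \<open>E\<close>-adjacent to \<open>x\<close>, which is a middle vertex for
  all of them. So in one of the graphs \<open>v\<close> reaches everything within two steps.\<close>

lemma exists_reducible:
  assumes C: "complementary V E F" and V: "5 \<le> card V"
  shows "\<exists>v. reducible V E F v \<or> reducible V F E v"
proof -
  obtain v where v: "v \<in> V" "connected_graph (V - {v}) E" "connected_graph (V - {v}) F"
    using exists_common_noncut_vertex[OF assms] by blast
  note D = complementaryD[OF C]
  show ?thesis
  proof (cases "\<forall>x\<in>V. {v, x} \<in> E \<longrightarrow> (\<exists>m\<in>V. {v, m} \<in> F \<and> {m, x} \<in> F)")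
    case True
    then show ?thesis using reducible_if_eccentricity_two[OF C V v] by blast
  next
    case False
    then obtain x where x: "x \<in> V" "{v, x} \<in> E" "\<And>m. m \<in> V \<Longrightarrow> {v, m} \<in> F \<Longrightarrow> {m, x} \<notin> F"
      by blast
    have "\<exists>m\<in>V. {v, m} \<in> E \<and> {m, y} \<in> E" if y: "y \<in> V" "{v, y} \<in> F" for y
    proof -
      have "y \<noteq> x" using x y C by (auto simp: complementary_def)
      then have "{x, y} \<in> E" using x(3)[OF y] D(6)[of y x] x y by (simp add: insert_commute)
      then show ?thesis using x by blast
    qed
    then show ?thesis
      using reducible_if_eccentricity_two[OF complementary_sym[OF C] V v(1,3,2)] by blast
  qed
qed

subsection \<open>Small graphs\<close>

text \<open>This turns an explicit coloring into a finite check: adjacent pairs need no path, every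
  other pair needs one listed path in either direction, and only a subgraph \<open>E\<^sub>0\<close>
  has to be colored.\<close>

lemma colorable_by_paths:
  assumes "E\<^sub>0 \<subseteq> E" "\<And>e. e \<in> E \<Longrightarrow> card e = 2" "3 \<le> k" "\<And>y. c y < k"
    and proper: "\<forall>e\<in>E\<^sub>0. \<forall>x\<in>e. c (Inl x) \<noteq> c (Inr e)"
    and paths: "\<forall>p\<in>set P. p \<noteq> [] \<and> distinct p \<and> set p \<subseteq> V \<and> set (path_edges p) \<subseteq> E\<^sub>0 \<and> total_rainbow c p"
    and pairs: "\<forall>u\<in>V. \<forall>v\<in>V. u = v \<or> {u, v} \<in> E\<^sub>0 \<or>
      (\<exists>p\<in>set P. hd p = u \<and> last p = v \<or> hd p = v \<and> last p = u)"
  shows "colorable V E k"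
proof (rule colorable_supergraph[OF _ assms(1-3)])
  have "total_rainbow_connected V E\<^sub>0 c"
  proof (rule total_rainbow_connected_symI)
    fix u v assume uv: "u \<in> V" "v \<in> V" "u \<noteq> v"
    then consider "{u, v} \<in> E\<^sub>0"
      | p where "p \<in> set P" "hd p = u \<and> last p = v \<or> hd p = v \<and> last p = u"
      using pairs by metis
    then show "\<exists>p. (path_between V E\<^sub>0 u p v \<or> path_between V E\<^sub>0 v p u) \<and> total_rainbow c p"
    proof cases
      case 1
      then have "path_between V E\<^sub>0 u [u, v] v" using path_between_edge uv by metis
      then show ?thesis using total_rainbow_edge by (intro exI conjI disjI1)
    next
      case (2 p)
      then have "path_between V E\<^sub>0 u p v \<or> path_between V E\<^sub>0 v p u" "total_rainbow c p"
        using paths by (auto simp: path_between_def)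
      then show ?thesis by blast
    qed
  qed
  then show "colorable V E\<^sub>0 k"
    unfolding colorable_def using assms(4) proper by blast
qed

text \<open>The complement of the path on five vertices; its three colors leave seven for the path.
  Here and in the following lemmas, items not listed have color 0.\<close>

lemma colorable_house:
  assumes "distinct [a, b, c, d, v]" "V = {a, b, c, d, v}" "\<And>e. e \<in> E \<Longrightarrow> card e = 2"
    and "{{b, d}, {a, d}, {a, c}, {b, v}, {c, v}, {d, v}} \<subseteq> E"
  shows "colorable V E 3"
  by (rule colorable_by_paths[OF assms(4,3), where c = "(\<lambda>_. 0)(Inl a := 2, Inl b := 1, Inl c := 2, Inl d := 2, Inl v := 2, Inr {a, d} := 1,
      Inr {c, v} := 1)" and
      P = "[[a, c, v], [c, a, d], [a, d, b], [b, v, c]]"])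
    (use assms(1,2) assms(1)[THEN distinct_rev[THEN iffD2]] in \<open>simp_all add: doubleton_eq_iff total_rainbow_def internal_vertices_def\<close>)

text \<open>The complement of the fork; its five colors and six for the fork give the bound
  11.\<close>

lemma colorable_cofork:
  assumes "distinct [a, b, c, d, v]" "V = {a, b, c, d, v}" "\<And>e. e \<in> E \<Longrightarrow> card e = 2"
    and "{{b, d}, {a, d}, {a, c}, {a, v}, {c, v}, {d, v}} \<subseteq> E"
  shows "colorable V E 5"
  by (rule colorable_by_paths[OF assms(4,3), where c = "(\<lambda>_. 0)(Inl a := 4, Inl d := 2, Inl v := 1, Inr {b, d} := 1, Inr {a, c} := 3,
      Inr {c, v} := 2)" and
      P = "[[a, d, b], [b, d, v], [b, d, a, c], [c, a, d]]"])
    (use assms(1,2) assms(1)[THEN distinct_rev[THEN iffD2]] in \<open>simp_all add: doubleton_eq_iff total_rainbow_def internal_vertices_def\<close>)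

text \<open>A triangle \<open>a\<close>, \<open>b\<close>, \<open>v\<close> with the tail
  \<open>b\<close>, \<open>c\<close>, \<open>d\<close>. The banner below is its complement, and five
  colors for each give 10.\<close>

lemma colorable_tailed_triangle:
  assumes "distinct [a, b, c, d, v]" "V = {a, b, c, d, v}" "\<And>e. e \<in> E \<Longrightarrow> card e = 2"
    and "{{a, b}, {b, c}, {c, d}, {a, v}, {b, v}} \<subseteq> E"
  shows "colorable V E 5"
  by (rule colorable_by_paths[OF assms(4,3), where c = "(\<lambda>_. 0)(Inl b := 4, Inl c := 2, Inr {a, b} := 3, Inr {c, d} := 1, Inr {a, v} := 1,
      Inr {b, v} := 3)" and
      P = "[[b, c, d], [a, b, c], [a, b, c, d], [c, b, v], [d, c, b, v]]"])
    (use assms(1,2) assms(1)[THEN distinct_rev[THEN iffD2]] in \<open>simp_all add: doubleton_eq_iff total_rainbow_def internal_vertices_def\<close>)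

lemma colorable_banner:
  assumes "distinct [a, b, c, d, v]" "V = {a, b, c, d, v}" "\<And>e. e \<in> E \<Longrightarrow> card e = 2"
    and "{{b, d}, {a, d}, {a, c}, {c, v}, {d, v}} \<subseteq> E"
  shows "colorable V E 5"
  by (rule colorable_by_paths[OF assms(4,3), where c = "(\<lambda>_. 0)(Inl a := 1, Inl c := 1, Inl d := 2, Inl v := 4, Inr {b, d} := 1, Inr {c, v} := 3)" and
      P = "[[a, d, b], [a, c, v], [b, d, v, c], [b, d, v], [c, v, d]]"])
    (use assms(1,2) assms(1)[THEN distinct_rev[THEN iffD2]] in \<open>simp_all add: doubleton_eq_iff total_rainbow_def internal_vertices_def\<close>)

text \<open>The five-cycle and the bull below are self-complementary, so one coloring serves both
  graphs of the pair.\<close>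

lemma colorable_pentagon:
  assumes "distinct [a, b, c, d, v]" "V = {a, b, c, d, v}" "\<And>e. e \<in> E \<Longrightarrow> card e = 2"
    and "{{a, b}, {b, c}, {c, d}, {a, v}, {d, v}} \<subseteq> E"
  shows "colorable V E 5"
  by (rule colorable_by_paths[OF assms(4,3), where c = "(\<lambda>_. 0)(Inl a := 1, Inl b := 2, Inl c := 3, Inl d := 4, Inl v := 1, Inr {b, c} := 1,
      Inr {d, v} := 2)" and
      P = "[[a, b, c], [a, v, d], [b, c, d], [b, c, d, v], [c, d, v]]"])
    (use assms(1,2) assms(1)[THEN distinct_rev[THEN iffD2]] in \<open>simp_all add: doubleton_eq_iff total_rainbow_def internal_vertices_def\<close>)

lemma colorable_bull:
  assumes "distinct [a, b, c, d, v]" "V = {a, b, c, d, v}" "\<And>e. e \<in> E \<Longrightarrow> card e = 2"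
    and "{{a, b}, {b, c}, {c, d}, {b, v}, {c, v}} \<subseteq> E"
  shows "colorable V E 5"
  by (rule colorable_by_paths[OF assms(4,3), where c = "(\<lambda>_. 0)(Inl a := 1, Inl b := 2, Inl c := 4, Inl v := 2, Inr {b, c} := 1, Inr {c, d} := 3,
      Inr {b, v} := 1)" and
      P = "[[a, b, c], [a, b, c, d], [a, b, v], [b, c, d], [d, c, v]]"])
    (use assms(1,2) assms(1)[THEN distinct_rev[THEN iffD2]] in \<open>simp_all add: doubleton_eq_iff total_rainbow_def internal_vertices_def\<close>)

text \<open>The complement of the fork with an extra vertex \<open>v\<close>. Adjacent to both
  \<open>p\<close> and \<open>q\<close>, it closes the five-cycle \<open>p\<close>,
  \<open>t\<close>, \<open>r\<close>, \<open>q\<close>, \<open>v\<close>, and four colors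
  suffice.\<close>

lemma colorable_cofork_pentagon:
  assumes "distinct [p, q, r, s, t, v]" "V = {p, q, r, s, t, v}" "\<And>e. e \<in> E \<Longrightarrow> card e = 2"
    and "{{p, t}, {q, r}, {q, s}, {r, s}, {r, t}, {s, t}, {p, v}, {q, v}} \<subseteq> E"
  shows "colorable V E 4"
  by (rule colorable_by_paths[OF assms(4,3), where c = "(\<lambda>_. 0)(Inl p := 1, Inl q := 2, Inl r := 2, Inl s := 2, Inl v := 2, Inr {p, t} := 2,
      Inr {r, t} := 1, Inr {s, t} := 1, Inr {q, v} := 1)" and
      P = "[[p, v, q], [q, r, t], [t, p, v], [p, t, r], [p, t, s], [r, q, v], [s, q, v]]"])
    (use assms(1,2) assms(1)[THEN distinct_rev[THEN iffD2]] in \<open>simp_all add: doubleton_eq_iff total_rainbow_def internal_vertices_def\<close>)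

text \<open>With a single edge at \<open>v\<close>, to the neighbor \<open>t\<close> of the leaf
  \<open>p\<close> here and to \<open>r\<close> in the next lemma, five colors suffice, to be paired
  with seven for the other graph.\<close>

lemma colorable_cofork_pendant_tip:
  assumes "distinct [p, q, r, s, t, v]" "V = {p, q, r, s, t, v}" "\<And>e. e \<in> E \<Longrightarrow> card e = 2"
    and "{{p, t}, {q, r}, {q, s}, {r, s}, {r, t}, {s, t}, {t, v}} \<subseteq> E"
  shows "colorable V E 5"
  by (rule colorable_by_paths[OF assms(4,3), where c = "(\<lambda>_. 0)(Inl p := 1, Inl q := 1, Inl r := 4, Inl s := 4, Inl t := 2, Inr {q, r} := 3,
      Inr {r, t} := 1, Inr {s, t} := 3, Inr {t, v} := 1)" and
      P = "[[p, t, v], [p, t, r], [p, t, s], [r, s, t, v], [s, t, v], [p, t, r, q], [q, r, t], [q, s, t, v]]"])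
    (use assms(1,2) assms(1)[THEN distinct_rev[THEN iffD2]] in \<open>simp_all add: doubleton_eq_iff total_rainbow_def internal_vertices_def\<close>)

lemma colorable_cofork_pendant_side:
  assumes "distinct [p, q, r, s, t, v]" "V = {p, q, r, s, t, v}" "\<And>e. e \<in> E \<Longrightarrow> card e = 2"
    and "{{p, t}, {q, r}, {q, s}, {r, s}, {r, t}, {s, t}, {r, v}} \<subseteq> E"
  shows "colorable V E 5"
  by (rule colorable_by_paths[OF assms(4,3), where c = "(\<lambda>_. 0)(Inl p := 1, Inl q := 1, Inl r := 4, Inl s := 4, Inl t := 2, Inr {q, s} := 3,
      Inr {r, t} := 1, Inr {s, t} := 1, Inr {r, v} := 3)" and
      P = "[[p, t, r], [p, t, s], [p, t, r, v], [q, r, v], [s, r, v], [t, r, v], [p, t, s, q], [q, r, t]]"])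
    (use assms(1,2) assms(1)[THEN distinct_rev[THEN iffD2]] in \<open>simp_all add: doubleton_eq_iff total_rainbow_def internal_vertices_def\<close>)

text \<open>The bound \<open>colorable_degree\<close> at a vertex of degree three would give eight;
  the explicit coloring saves one.\<close>

lemma colorable_double_star:
  assumes "distinct [p, q, r, s, t, v]" "V = {p, q, r, s, t, v}" "\<And>e. e \<in> E \<Longrightarrow> card e = 2"
    and "{{p, q}, {p, r}, {p, s}, {q, t}, {q, v}} \<subseteq> E"
  shows "colorable V E 7"
  by (rule colorable_by_paths[OF assms(4,3), where c = "(\<lambda>_. 0)(Inl p := 5, Inl q := 2, Inr {p, r} := 4, Inr {p, s} := 6, Inr {q, t} := 1,
      Inr {q, v} := 3)" and
      P = "[[p, q, t], [p, q, v], [q, p, r], [q, p, s], [r, p, s], [r, p, q, t], [r, p, q, v], [s, p, q, t], [s, p, q, v], [t, q, v]]"])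
    (use assms(1,2) assms(1)[THEN distinct_rev[THEN iffD2]] in \<open>simp_all add: doubleton_eq_iff total_rainbow_def internal_vertices_def\<close>)

text \<open>The fork with \<open>v\<close> joined to all of it but the center \<open>p\<close> or,
  in the next lemma, but \<open>q\<close>. Four colors go with the eight that the degree bound gives
  for the complement.\<close>

lemma colorable_fork_joined_except_center:
  assumes "distinct [p, q, r, s, t, v]" "V = {p, q, r, s, t, v}" "\<And>e. e \<in> E \<Longrightarrow> card e = 2"
    and "{{p, q}, {p, r}, {p, s}, {q, t}, {q, v}, {r, v}, {s, v}, {t, v}} \<subseteq> E"
  shows "colorable V E 4"
  by (rule colorable_by_paths[OF assms(4,3), where c = "(\<lambda>_. 0)(Inl p := 2, Inl q := 2, Inl r := 2, Inl v := 2, Inr {p, r} := 1, Inr {p, s} := 1,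
      Inr {q, t} := 1, Inr {q, v} := 1, Inr {s, v} := 1, Inr {t, v} := 3)" and
      P = "[[p, q, v], [p, q, t], [q, p, r], [q, p, s], [r, v, s], [r, v, t], [s, v, t]]"])
    (use assms(1,2) assms(1)[THEN distinct_rev[THEN iffD2]] in \<open>simp_all add: doubleton_eq_iff total_rainbow_def internal_vertices_def\<close>)

lemma colorable_fork_joined_except_neighbor:
  assumes "distinct [p, q, r, s, t, v]" "V = {p, q, r, s, t, v}" "\<And>e. e \<in> E \<Longrightarrow> card e = 2"
    and "{{p, q}, {p, r}, {p, s}, {q, t}, {p, v}, {r, v}, {s, v}, {t, v}} \<subseteq> E"
  shows "colorable V E 4"
  by (rule colorable_by_paths[OF assms(4,3), where c = "(\<lambda>_. 0)(Inl p := 2, Inl q := 2, Inl r := 2, Inl v := 2, Inr {p, r} := 1, Inr {p, s} := 1,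
      Inr {q, t} := 1, Inr {p, v} := 1, Inr {s, v} := 1, Inr {t, v} := 3)" and
      P = "[[p, q, t], [q, p, v], [q, p, r], [q, p, s], [r, v, s], [r, v, t], [s, v, t]]"])
    (use assms(1,2) assms(1)[THEN distinct_rev[THEN iffD2]] in \<open>simp_all add: doubleton_eq_iff total_rainbow_def internal_vertices_def\<close>)

section \<open>Complementary pairs of orders four to six\<close>

lemma connected_graph_neighbor:
  assumes "connected_graph V E" "u \<in> V" "z \<in> V" "z \<noteq> u"
  shows "\<exists>y\<in>V. y \<noteq> u \<and> {u, y} \<in> E"
  using connected_graph_cut[OF assms(1), of u "{u}" z] assms by blast

text \<open>The path on four vertices is self-complementary: the pairs listed for \<open>F\<close>
  form the path \<open>b\<close>, \<open>d\<close>, \<open>a\<close>, \<open>c\<close>. Listing both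
  sides makes exchanging the graphs a relabeling.\<close>

definition path4 :: "'a set set \<Rightarrow> 'a set set \<Rightarrow> 'a \<Rightarrow> 'a \<Rightarrow> 'a \<Rightarrow> 'a \<Rightarrow> bool" where
  "path4 E F a b c d \<longleftrightarrow> {{a, b}, {b, c}, {c, d}} \<subseteq> E \<and> {{a, c}, {a, d}, {b, d}} \<subseteq> F"

lemma path4_complement: "path4 E F a b c d \<Longrightarrow> path4 F E b d a c"
  by (auto simp: path4_def insert_commute)

text \<open>The only possible \<open>E\<close>-neighbor of \<open>p\<close> is \<open>q\<close>, so
  \<open>q\<close> has a further one, say \<open>r\<close>. Then \<open>q\<close> needs
  \<open>s\<close> as an \<open>F\<close>-neighbor, and \<open>s\<close> has only \<open>r\<close>
  left as an \<open>E\<close>-neighbor.\<close>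

lemma path4_if_degree_two:
  assumes C: "complementary V E F" and V: "V = {p, q, r, s}" "distinct [p, q, r, s]"
    and F: "{p, r} \<in> F" "{p, s} \<in> F"
  shows "\<exists>a b c d. distinct [a, b, c, d] \<and> V = {a, b, c, d} \<and> path4 E F a b c d"
proof -
  note D = complementaryD[OF C]
  have E: "{x, y} \<in> E \<longleftrightarrow> {x, y} \<notin> F" if "x \<in> V" "y \<in> V" "x \<noteq> y" for x y
    using D(6) that by blast
  have pq: "{p, q} \<in> E"
    using connected_graph_neighbor[OF D(2), of p q] E[of p r] E[of p s] F V by auto
  have main: ?thesis if V: "V = {p, q, r, s}" "distinct [p, q, r, s]"
    and F: "{p, r} \<in> F" "{p, s} \<in> F" and qr: "{q, r} \<in> E" for r s
  proof -
    have "{q, s} \<in> F"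
      using connected_graph_neighbor[OF D(3), of q p] E[of q p] E[of q r] pq qr V
      by (auto simp: insert_commute)
    moreover have "{s, r} \<in> E"
      using connected_graph_neighbor[OF D(2), of s p] E[of s p] E[of s q] F \<open>{q, s} \<in> F\<close> V
      by (auto simp: insert_commute)
    ultimately have "path4 E F p q r s"
      using F pq qr by (auto simp: path4_def insert_commute)
    then show ?thesis using V by blast
  qed
  obtain x y where xy: "x \<in> {p, q}" "y \<in> V" "y \<notin> {p, q}" "{x, y} \<in> E"
    using connected_graph_cut[OF D(2), of p "{p, q}" r] V by auto
  then have "x = q" using F V E[of p r] E[of p s] by auto
  then consider "{q, r} \<in> E" | "{q, s} \<in> E" using xy V by auto
  then show ?thesis
  proof cases
    case 1
    then show ?thesis using main[of r s] V F by blast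
  next
    case 2
    moreover have "V = {p, q, s, r}" "distinct [p, q, s, r]" using V by auto
    ultimately show ?thesis using main[of s r] F by blast
  qed
qed

text \<open>Two of the three pairs at a vertex \<open>p\<close> lie in the same graph. If that is
  \<open>E\<close>, the graphs are exchanged and the resulting path is complemented back.\<close>

lemma order4_path:
  assumes C: "complementary V E F" and V: "card V = 4"
  shows "\<exists>a b c d. distinct [a, b, c, d] \<and> V = {a, b, c, d} \<and> path4 E F a b c d"
proof -
  note D = complementaryD[OF C]
  obtain l where "set l = V" "distinct l" using finite_distinct_list[OF D(1)] by blast
  moreover then have "length l = 4" using V distinct_card by fastforce
  then obtain p x y z where "l = [p, x, y, z]"
    by (auto simp: length_Suc_conv numeral_eq_Suc)
  ultimately have V: "V = {p, x, y, z}" and dist: "distinct [p, x, y, z]" by auto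
  have P: "\<exists>a b c d. distinct [a, b, c, d] \<and> V = {a, b, c, d} \<and> path4 E F a b c d"
    if "complementary V E F" "({p, y} \<in> F \<and> {p, z} \<in> F) \<or> ({p, x} \<in> F \<and> {p, z} \<in> F) \<or>
       ({p, x} \<in> F \<and> {p, y} \<in> F)" for E F
    using that(2)
  proof (elim disjE conjE)
    assume "{p, y} \<in> F" "{p, z} \<in> F"
    then show ?thesis using path4_if_degree_two[OF that(1) V dist] by blast
  next
    assume "{p, x} \<in> F" "{p, z} \<in> F"
    moreover have "V = {p, y, x, z}" "distinct [p, y, x, z]" using V dist by auto
    ultimately show ?thesis using path4_if_degree_two[OF that(1), of p y x z] by blast
  next
    assume "{p, x} \<in> F" "{p, y} \<in> F"
    moreover have "V = {p, z, x, y}" "distinct [p, z, x, y]" using V dist by auto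
    ultimately show ?thesis using path4_if_degree_two[OF that(1), of p z x y] by blast
  qed
  have "{p, t} \<in> E \<or> {p, t} \<in> F" if "t \<in> {x, y, z}" for t
    using that D(6)[of p t] V dist by auto
  then consider "({p, y} \<in> F \<and> {p, z} \<in> F) \<or> ({p, x} \<in> F \<and> {p, z} \<in> F) \<or>
       ({p, x} \<in> F \<and> {p, y} \<in> F)" | "({p, y} \<in> E \<and> {p, z} \<in> E) \<or> ({p, x} \<in> E \<and> {p, z} \<in> E) \<or>
       ({p, x} \<in> E \<and> {p, y} \<in> E)" by blast
  then show ?thesis
  proof cases
    case 1
    then show ?thesis using P[OF C] by blast
  next
    case 2
    then obtain a b c d where
      abcd: "distinct [a, b, c, d]" "V = {a, b, c, d}" "path4 F E a b c d"
      using P[OF complementary_sym[OF C]] by blast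
    have "distinct [b, d, a, c]" "V = {b, d, a, c}" using abcd(1,2) by auto
    then show ?thesis using path4_complement[OF abcd(3)] by blast
  qed
qed

text \<open>The fork, or chair: a star with center \<open>p\<close> and three edges, the one to
  \<open>q\<close> extended by an edge to \<open>t\<close>. As in \<open>path4\<close>, the
  complement is listed too.\<close>

definition fork :: "'a set \<Rightarrow> 'a set set \<Rightarrow> 'a set set \<Rightarrow> bool" where
  "fork V E F \<longleftrightarrow> (\<exists>p q r s t. distinct [p, q, r, s, t] \<and> V = {p, q, r, s, t} \<and>
     {{p, q}, {p, r}, {p, s}, {q, t}} \<subseteq> E \<and>
     {{p, t}, {q, r}, {q, s}, {r, s}, {r, t}, {s, t}} \<subseteq> F)"

lemma sum_colorable_fork:
  assumes C: "complementary V E F" and "fork V E F"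
  shows "sum_colorable V E F 11"
proof -
  note D = complementaryD[OF C]
  obtain p q r s t where V: "distinct [p, q, r, s, t]" "V = {p, q, r, s, t}"
    and E: "{{p, q}, {p, r}, {p, s}, {q, t}} \<subseteq> E"
    and F: "{{p, t}, {q, r}, {q, s}, {r, s}, {r, t}, {s, t}} \<subseteq> F"
    using assms(2) unfolding fork_def by (elim exE conjE) (rule that)
  have "card {q, r, s} = 3" "card V = 5" using V by auto
  moreover have "{p, x} \<in> E" if "x \<in> {q, r, s}" for x using that E by auto
  \<comment> \<open>The star at \<open>p\<close> has three leaves:
    \<open>2 * 5 - 1 - 3 = 6\<close>.\<close>
  ultimately have "colorable V E 6"
    using colorable_degree[OF D(1,2,4), of "{q, r, s}" p] by simp
  moreover have "colorable V F 5"
    by (rule colorable_cofork[of r p q t s]) (use V F D(5) in \<open>auto simp: insert_commute\<close>)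
  ultimately show ?thesis by (rule sum_colorableI) simp
qed

text \<open>The five adjacencies of \<open>v\<close> to a path on four vertices give the path, the
  fork, the triangle with a tail, the five-cycle and the bull, in this order. Up to reversing and
  complementing the path, these are all cases in which \<open>v\<close> is isolated in neither
  graph.\<close>

lemma order5_cases:
  assumes C: "complementary V E F" and V: "distinct [a, b, c, d, v]" "V = {a, b, c, d, v}"
    and P: "path4 E F a b c d"
    and cases: "{a, v} \<in> E \<and> {b, v} \<in> F \<and> {c, v} \<in> F \<and> {d, v} \<in> F \<or>
      {a, v} \<in> F \<and> {b, v} \<in> E \<and> {c, v} \<in> F \<and> {d, v} \<in> F \<or>
      {a, v} \<in> E \<and> {b, v} \<in> E \<and> {c, v} \<in> F \<and> {d, v} \<in> F \<or>
      {a, v} \<in> E \<and> {b, v} \<in> F \<and> {c, v} \<in> F \<and> {d, v} \<in> E \<or>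
      {a, v} \<in> F \<and> {b, v} \<in> E \<and> {c, v} \<in> E \<and> {d, v} \<in> F"
  shows "sum_colorable V E F 10 \<or> fork V E F"
proof -
  note D = complementaryD[OF C]
  have E: "{a, b} \<in> E" "{b, c} \<in> E" "{c, d} \<in> E" and F: "{a, c} \<in> F" "{a, d} \<in> F" "{b, d} \<in> F"
    using P by (auto simp: path4_def)
  have cE: "card e = 2" if "e \<in> E" for e using D(4) that by blast
  have cF: "card e = 2" if "e \<in> F" for e using D(5) that by blast
  have W: "distinct [b, d, a, c, v]" "V = {b, d, a, c, v}" using V by auto
  from cases show ?thesis
  proof (elim disjE conjE)
    assume v: "{a, v} \<in> E" "{b, v} \<in> F" "{c, v} \<in> F" "{d, v} \<in> F"
    have "card {a, c} = 2" "card V = 5" using V by auto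
    moreover have "{b, x} \<in> E" if "x \<in> {a, c}" for x
      using that E by (auto simp: insert_commute)
    ultimately have "colorable V E 7"
      using colorable_degree[OF D(1,2,4), of "{a, c}" b] by simp
    moreover have "colorable V F 3"
      by (rule colorable_house[OF V cF]) (use F v in simp_all)
    ultimately show ?thesis by (intro disjI1 sum_colorableI) (assumption, assumption, simp)
  next
    assume v: "{a, v} \<in> F" "{b, v} \<in> E" "{c, v} \<in> F" "{d, v} \<in> F"
    have "fork V E F"
      unfolding fork_def
      by (rule exI[of _ b], rule exI[of _ c], rule exI[of _ a], rule exI[of _ v], rule exI[of _ d])
        (use V E F v in \<open>auto simp: insert_commute\<close>)
    then show ?thesis ..
  next
    assume v: "{a, v} \<in> E" "{b, v} \<in> E" "{c, v} \<in> F" "{d, v} \<in> F"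
    have "colorable V E 5"
      by (rule colorable_tailed_triangle[OF V cE]) (use E v in simp_all)
    moreover have "colorable V F 5"
      by (rule colorable_banner[OF V cF]) (use F v in simp_all)
    ultimately show ?thesis by (intro disjI1 sum_colorableI) (assumption, assumption, simp)
  next
    assume v: "{a, v} \<in> E" "{b, v} \<in> F" "{c, v} \<in> F" "{d, v} \<in> E"
    have "colorable V E 5"
      by (rule colorable_pentagon[OF V cE]) (use E v in simp_all)
    moreover have "colorable V F 5"
      by (rule colorable_pentagon[OF W cF]) (use F v in \<open>simp_all add: insert_commute\<close>)
    ultimately show ?thesis by (intro disjI1 sum_colorableI) (assumption, assumption, simp)
  next
    assume v: "{a, v} \<in> F" "{b, v} \<in> E" "{c, v} \<in> E" "{d, v} \<in> F"
    have "colorable V E 5"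
      by (rule colorable_bull[OF V cE]) (use E v in simp_all)
    moreover have "colorable V F 5"
      by (rule colorable_bull[OF W cF]) (use F v in \<open>simp_all add: insert_commute\<close>)
    ultimately show ?thesis by (intro disjI1 sum_colorableI) (assumption, assumption, simp)
  qed
qed

lemma order5:
  assumes C: "complementary V E F" and V: "card V = 5"
  shows "sum_colorable V E F 10 \<or> fork V E F \<or> fork V F E"
proof -
  note D = complementaryD[OF C]
  obtain v where v: "v \<in> V" "connected_graph (V - {v}) E" "connected_graph (V - {v}) F"
    using exists_common_noncut_vertex[OF C] V by auto
  have "complementary (V - {v}) {e \<in> E. v \<notin> e} {e \<in> F. v \<notin> e}"
    by (rule complementary_delete[OF C]) (use v in \<open>simp_all add: connected_graph_restrict\<close>)
  moreover have "card (V - {v}) = 4" using v V by simp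
  ultimately obtain a b c d where "distinct [a, b, c, d]" and Vv: "V - {v} = {a, b, c, d}"
    and "path4 {e \<in> E. v \<notin> e} {e \<in> F. v \<notin> e} a b c d"
    using order4_path by blast
  then have dist: "distinct [a, b, c, d, v]" and P: "path4 E F a b c d"
    by (auto simp: path4_def)
  have V': "V = {a, b, c, d, v}" using Vv v by auto
  have iff: "{x, v} \<in> F \<longleftrightarrow> {x, v} \<notin> E" if "x \<in> {a, b, c, d}" for x
    using that D(6)[of x v] dist V' by auto
  note iffs = iff[of a, simplified] iff[of b, simplified] iff[of c, simplified] iff[of d, simplified]
  have "{a, v} \<in> E \<or> {b, v} \<in> E \<or> {c, v} \<in> E \<or> {d, v} \<in> E"
    using connected_graph_neighbor[OF D(2), of v a] dist V' by (auto simp: insert_commute)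
  moreover have "{a, v} \<in> F \<or> {b, v} \<in> F \<or> {c, v} \<in> F \<or> {d, v} \<in> F"
    using connected_graph_neighbor[OF D(3), of v a] dist V' by (auto simp: insert_commute)
  moreover have perm: "distinct [b, d, a, c, v]" "V = {b, d, a, c, v}"
    "distinct [d, c, b, a, v]" "V = {d, c, b, a, v}" "distinct [c, a, d, b, v]" "V = {c, a, d, b, v}"
    using dist V' by auto
  note C' = complementary_sym[OF C]
  \<comment> \<open>Complementing twice reverses the path, so there are four labelings; their cases
    together exhaust the adjacencies of \<open>v\<close>.\<close>
  note P1 = path4_complement[OF P] and P2 = path4_complement[OF path4_complement[OF P]]
    and P3 = path4_complement[OF path4_complement[OF path4_complement[OF P]]]
  note cases = order5_cases[OF C dist V' P] order5_cases[OF C' perm(1,2) P1]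
    order5_cases[OF C perm(3,4) P2] order5_cases[OF C' perm(5,6) P3]
  ultimately have "sum_colorable V E F 10 \<or> sum_colorable V F E 10 \<or> fork V E F \<or> fork V F E"
    using cases iffs by argo
  then show ?thesis using sum_colorable_sym by blast
qed

text \<open>If \<open>v\<close> is \<open>F\<close>-adjacent to \<open>p\<close> and
  \<open>q\<close>, eight colors for \<open>E\<close> and four for \<open>F\<close> suffice.
  Otherwise seven suffice for \<open>E\<close>, by degree four at \<open>p\<close> or by a double
  star, and five for \<open>F\<close> if \<open>v\<close> is \<open>F\<close>-adjacent to
  \<open>r\<close>, \<open>s\<close> or \<open>t\<close>; if it is not, four and eight do.\<close>

lemma order6_fork:
  assumes C: "complementary V E F" and v: "v \<in> V"
    and fork: "fork (V - {v}) {e \<in> E. v \<notin> e} {e \<in> F. v \<notin> e}"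
  shows "sum_colorable V E F 12"
proof -
  note D = complementaryD[OF C]
  obtain p q r s t where d5: "distinct [p, q, r, s, t]" and Vv: "V - {v} = {p, q, r, s, t}"
    and "{{p, q}, {p, r}, {p, s}, {q, t}} \<subseteq> {e \<in> E. v \<notin> e}"
    "{{p, t}, {q, r}, {q, s}, {r, s}, {r, t}, {s, t}} \<subseteq> {e \<in> F. v \<notin> e}"
    using fork unfolding fork_def by (elim exE conjE) (rule that)
  then have E: "{p, q} \<in> E" "{p, r} \<in> E" "{p, s} \<in> E" "{q, t} \<in> E"
    and F: "{p, t} \<in> F" "{q, r} \<in> F" "{q, s} \<in> F" "{r, s} \<in> F" "{r, t} \<in> F" "{s, t} \<in> F"
    by auto
  have V: "distinct [p, q, r, s, t, v]" "V = {p, q, r, s, t, v}" using d5 Vv v by auto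
  have W: "distinct [p, q, s, r, t, v]" "V = {p, q, s, r, t, v}" using V by auto
  have card: "card V = 6" using V by simp
  have cE: "card e = 2" if "e \<in> E" for e using D(4) that by blast
  have cF: "card e = 2" if "e \<in> F" for e using D(5) that by blast
  have iff: "{x, v} \<in> F \<longleftrightarrow> {x, v} \<notin> E" if "x \<in> {p, q, r, s, t}" for x
    using that D(6)[of x v] V by auto
  have E8: "colorable V E 8"
  proof -
    have "card {q, r, s} = 3" using V by auto
    moreover have "{p, x} \<in> E" if "x \<in> {q, r, s}" for x using that E by auto
    ultimately show ?thesis
      using colorable_degree[OF D(1,2,4), of "{q, r, s}" p] card by simp
  qed
  have F8: "colorable V F 8"
  proof -
    have "card {q, s, t} = 3" using V by auto
    moreover have "{r, x} \<in> F" if "x \<in> {q, s, t}" for x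
      using that F by (auto simp: insert_commute)
    ultimately show ?thesis
      using colorable_degree[OF D(1,3,5), of "{q, s, t}" r] card by simp
  qed
  show ?thesis
  proof (cases "{p, v} \<in> E \<or> {q, v} \<in> E")
    case False
    then have "{p, v} \<in> F" "{q, v} \<in> F" using iff by auto
    then have "colorable V F 4"
      by (intro colorable_cofork_pentagon[OF V cF]) (use F in simp_all)
    then show ?thesis using E8 by (intro sum_colorableI) (assumption, assumption, simp)
  next
    case True
    then have E7: "colorable V E 7"
    proof
      assume pv: "{p, v} \<in> E"
      have "card {q, r, s, v} = 4" using V by auto
      moreover have "{p, x} \<in> E" if "x \<in> {q, r, s, v}" for x using that E pv by auto
      ultimately show ?thesis
        using colorable_degree[OF D(1,2,4), of "{q, r, s, v}" p] card by simp
    next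
      assume "{q, v} \<in> E"
      then show ?thesis by (intro colorable_double_star[OF V cE]) (use E in simp_all)
    qed
    consider "{t, v} \<in> F \<or> {r, v} \<in> F \<or> {s, v} \<in> F" | "{r, v} \<in> E" "{s, v} \<in> E" "{t, v} \<in> E"
      using iff by auto
    then show ?thesis
    proof cases
      case 1
      then have "colorable V F 5"
      proof (elim disjE)
        assume "{t, v} \<in> F"
        then show ?thesis by (intro colorable_cofork_pendant_tip[OF V cF]) (use F in simp_all)
      next
        assume "{r, v} \<in> F"
        then show ?thesis by (intro colorable_cofork_pendant_side[OF V cF]) (use F in simp_all)
      next
        assume "{s, v} \<in> F"
        then show ?thesis
          by (intro colorable_cofork_pendant_side[OF W cF]) (use F in \<open>simp_all add: insert_commute\<close>)
      qed
      then show ?thesis using E7 by (intro sum_colorableI) (assumption, assumption, simp)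
    next
      case 2
      have "colorable V E 4"
        using True
      proof
        assume "{p, v} \<in> E"
        then show ?thesis by (intro colorable_fork_joined_except_neighbor[OF V cE]) (use E 2 in simp_all)
      next
        assume "{q, v} \<in> E"
        then show ?thesis by (intro colorable_fork_joined_except_center[OF V cE]) (use E 2 in simp_all)
      qed
      then show ?thesis using F8 by (intro sum_colorableI) (assumption, assumption, simp)
    qed
  qed
qed

text \<open>A reducible vertex is deleted from both graphs. From order six this leads to order five,
  where \<open>order5\<close> gives the bound 10 except for forks; their extensions are colored by
  \<open>order6_fork\<close>.\<close>

lemma sum_colorable_upper_bound:
  assumes "complementary V E F" "6 \<le> card V"
  shows "sum_colorable V E F (2 * card V)"
  using assms
proof (induction "card V" arbitrary: V E F rule: less_induct)
  case less
  note C = less.prems(1)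
  have step: "sum_colorable V E F (2 * card V)"
    if C: "complementary V E F" and red: "reducible V E F v" for E F v
  proof -
    have v: "v \<in> V" using red by (simp add: reducible_def)
    let ?E = "{e \<in> E. v \<notin> e}" and ?F = "{e \<in> F. v \<notin> e}"
    have C': "complementary (V - {v}) ?E ?F"
      by (rule complementary_delete[OF C])
        (use red in \<open>simp_all add: connected_graph_restrict reducible_def\<close>)
    have card: "card (V - {v}) = card V - 1" using v by simp
    have reduce: "sum_colorable V E F (2 * card V)"
      if "sum_colorable (V - {v}) ?E ?F (2 * (card V - 1))"
      using sum_colorable_reducible[OF C red _ that] less.prems(2) by simp
    show ?thesis
    proof (cases "card V = 6")
      case True
      then have "card (V - {v}) = 5" using card by simp
      from order5[OF C' this] show ?thesis
      proof (elim disjE)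
        assume "sum_colorable (V - {v}) ?E ?F 10"
        then show ?thesis using reduce True by simp
      next
        assume "fork (V - {v}) ?E ?F"
        then show ?thesis using order6_fork[OF C v] True by simp
      next
        assume "fork (V - {v}) ?F ?E"
        then have "sum_colorable V F E 12" by (rule order6_fork[OF complementary_sym[OF C] v])
        then show ?thesis using sum_colorable_sym True by auto
      qed
    next
      case False
      then have "sum_colorable (V - {v}) ?E ?F (2 * card (V - {v}))"
        using less.hyps[OF _ C'] card less.prems(2) by simp
      then show ?thesis using reduce card by simp
    qed
  qed
  obtain v where "reducible V E F v \<or> reducible V F E v"
    using exists_reducible[OF C] less.prems(2) by auto
  then show ?case
    using step[OF C] step[OF complementary_sym[OF C]] sum_colorable_sym by blast
qed

subsection \<open>Bounds on the total-rainbow connection number\<close>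

lemma complementary_complement_edges:
  assumes "simple_graph V E" "connected_graph V E" "connected_graph V (complement_edges V E)"
  shows "complementary V E (complement_edges V E)"
  using assms by (auto simp: complementary_def simple_graph_def complement_edges_def)

lemma trc_le:
  assumes "colorable V E k"
  shows "trc V E \<le> k"
proof -
  obtain c where c: "total_rainbow_connected V E c" "\<And>y. c y < k"
    using assms unfolding colorable_def by blast
  have "colors_used V E c \<subseteq> {..<k}" using c(2) by (auto simp: colors_used_def)
  then have "card (colors_used V E c) \<le> k" using card_mono[of "{..<k}"] by fastforce
  moreover have "trc V E \<le> card (colors_used V E c)"
    unfolding trc_def by (rule Least_le) (use c in blast)
  ultimately show ?thesis by simp
qed

lemma trc_sum_le:
  assumes "sum_colorable V E F s"
  shows "trc V E + trc V F \<le> s"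
  using assms trc_le unfolding sum_colorable_def by (metis add_mono order_trans)

text \<open>The \<open>LEAST\<close> in \<open>trc\<close> is attained only if some suitable
  coloring exists, which \<open>colorable\<close> provides.\<close>

lemma trc_attained:
  assumes "colorable V E k"
  obtains c where "total_rainbow_connected V E c" "card (colors_used V E c) = trc V E"
proof -
  have "\<exists>k c. total_rainbow_connected V E c \<and> card (colors_used V E c) = k"
    using assms unfolding colorable_def by blast
  then have "\<exists>c. total_rainbow_connected V E c \<and> card (colors_used V E c) = trc V E"
    unfolding trc_def by (rule LeastI_ex)
  then show ?thesis using that by blast
qed

lemma items_subset_colors_used:
  assumes "path_between V E u p v"
  shows "c ` (Inr ` set (path_edges p) \<union> Inl ` set (internal_vertices p)) \<subseteq> colors_used V E c"
  unfolding colors_used_def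
  by (rule image_mono) (use assms internal_vertices_subset[of p] in \<open>auto simp: path_between_def\<close>)

lemma finite_colors_used:
  "finite V \<Longrightarrow> (\<And>e. e \<in> E \<Longrightarrow> e \<subseteq> V) \<Longrightarrow> finite (colors_used V E c)"
  unfolding colors_used_def by (meson finite_Pow_iff finite_UnI finite_imageI finite_subset PowI subsetI)

text \<open>A path on \<open>l\<close> vertices has \<open>l - 1\<close> edges and
  \<open>l - 2\<close> internal vertices, all of which need distinct colors.\<close>

lemma trc_ge_path_length:
  assumes "colorable V E k" "finite V" "\<And>e. e \<in> E \<Longrightarrow> e \<subseteq> V" "u \<in> V" "v \<in> V" "u \<noteq> v"
    and len: "\<And>p. path_between V E u p v \<Longrightarrow> l \<le> length p"
  shows "2 * l - 3 \<le> trc V E"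
proof -
  obtain c where c: "total_rainbow_connected V E c" "card (colors_used V E c) = trc V E"
    using trc_attained[OF assms(1)] by blast
  then obtain p where p: "path_between V E u p v" "total_rainbow c p"
    using assms(4-6) unfolding total_rainbow_connected_def by blast
  let ?is = "map Inr (path_edges p) @ map Inl (internal_vertices p)"
  have "card (set (map c ?is)) = length (map c ?is)"
    using p(2) unfolding total_rainbow_def by (rule distinct_card)
  also have "\<dots> = (length p - 1) + (length p - 1 - 1)"
    by (simp add: length_path_edges internal_vertices_def)
  finally have "2 * l - 3 \<le> card (set (map c ?is))" using len[OF p(1)] by linarith
  also have "\<dots> \<le> card (colors_used V E c)"
  proof (rule card_mono)
    show "finite (colors_used V E c)" using finite_colors_used assms(2,3) by blast
    have "set (map c ?is) = c ` (Inr ` set (path_edges p) \<union> Inl ` set (internal_vertices p))"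
      by (simp add: image_Un image_image)
    then show "set (map c ?is) \<subseteq> colors_used V E c" using items_subset_colors_used[OF p(1)] by simp
  qed
  finally show ?thesis using c(2) by simp
qed

lemma path_length_ge_3:
  assumes "path_between V E u p v" "u \<noteq> v" "{u, v} \<notin> E"
  shows "3 \<le> length p"
proof -
  obtain q where q: "p = u # q" using assms(1) by (cases p) (auto simp: path_between_def)
  then obtain w q' where "q = w # q'" using assms by (cases q) (auto simp: path_between_def)
  then show ?thesis using assms q by (cases q') (auto simp: path_between_def)
qed

lemma path_length_ge_4:
  assumes "path_between V E u p v" "u \<noteq> v" "{u, v} \<notin> E" "\<And>x. {u, x} \<in> E \<Longrightarrow> {x, v} \<notin> E"
  shows "4 \<le> length p"
proof (rule ccontr)
  assume "\<not> 4 \<le> length p"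
  then have "length p = 3" using path_length_ge_3[OF assms(1-3)] by simp
  then obtain a b c where "p = [a, b, c]" by (auto simp: length_Suc_conv numeral_eq_Suc)
  then show False using assms by (auto simp: path_between_def)
qed

text \<open>Degree two at \<open>b\<close> gives the upper bound \<open>2 * 4 - 1 - 2 = 5\<close>;
  paths from \<open>a\<close> to \<open>d\<close> have at least four vertices, which gives the lower
  bound \<open>2 * 4 - 3 = 5\<close>. The complement is again such a path, whence the sum
  10.\<close>

lemma order4_trc:
  assumes C: "complementary V E F" and V: "distinct [a, b, c, d]" "V = {a, b, c, d}"
    and P: "path4 E F a b c d"
  shows "trc V E = 5"
proof -
  note D = complementaryD[OF C]
  have E: "{a, b} \<in> E" "{b, c} \<in> E" "{c, d} \<in> E" and F: "{a, c} \<in> F" "{a, d} \<in> F" "{b, d} \<in> F"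
    using P by (auto simp: path4_def)
  have nE: "{x, y} \<notin> E" if "{x, y} \<in> F" for x y
    using that C by (auto simp: complementary_def)
  have "card {a, c} = 2" "card V = 4" using V by auto
  moreover have "{b, x} \<in> E" if "x \<in> {a, c}" for x
    using that E by (auto simp: insert_commute)
  ultimately have col: "colorable V E 5"
    using colorable_degree[OF D(1,2,4), of "{a, c}" b] by simp
  have "{x, d} \<notin> E" if "{a, x} \<in> E" for x
  proof -
    have "x \<in> V" "x \<noteq> a" using D(4)[OF that] by auto
    then have "x = b" using that V nE[OF F(1)] nE[OF F(2)] by auto
    then show ?thesis using nE[OF F(3)] by simp
  qed
  then have "4 \<le> length p" if "path_between V E a p d" for p
    using path_length_ge_4[OF that _ nE[OF F(2)]] V by auto
  then have "2 * 4 - 3 \<le> trc V E"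
    by (rule trc_ge_path_length[OF col D(1), rotated 4]) (use D(4) V in auto)
  then show ?thesis using trc_le[OF col] by simp
qed

section \<open>The extremal graphs\<close>

lemma path_contains_bridge:
  assumes "path_between V E u p v" "u \<in> S" "v \<notin> S"
    and "\<And>x y. x \<in> S \<Longrightarrow> y \<notin> S \<Longrightarrow> {x, y} \<in> E \<Longrightarrow> {x, y} = e"
  shows "e \<in> set (path_edges p)"
proof -
  obtain x y where xy: "x \<in> S" "y \<notin> S" "{x, y} \<in> set (path_edges p)"
    using path_crosses[of p S] assms(1-3) by (auto simp: path_between_def)
  moreover have "{x, y} \<in> E" using xy assms(1) by (auto simp: path_between_def)
  ultimately show ?thesis using assms(4)[of x y] by simp
qed

lemma internal_if_not_end:
  assumes "path_between V E u p v" "x \<in> set p" "x \<noteq> u" "x \<noteq> v"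
  shows "x \<in> set (internal_vertices p)"
proof -
  obtain q where q: "p = u # q" using assms(1) by (cases p) (auto simp: path_between_def)
  then have "x \<in> set q" using assms by auto
  then have "q = butlast q @ [v]"
    using assms(1) q by (metis append_butlast_last_id empty_iff last_ConsR list.set(1) path_between_def)
  then have "x \<in> set (butlast q)" using \<open>x \<in> set q\<close> assms(4)
    by (metis Un_iff empty_iff insert_iff list.set set_append)
  then show ?thesis using q by (simp add: internal_vertices_def)
qed

text \<open>The ends of the path are joined only through all \<open>n\<close> vertices, which forces
  \<open>2 * n - 3\<close> colors; the complement is not complete and needs three. The general upper
  bound provides colorings of both and turns the sum into an equality.\<close>

lemma path_graph_trc:
  assumes n: "6 \<le> n" and V: "V = {..<n}" and E: "E = {{i, Suc i} | i. Suc i < n}"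
  shows "simple_graph V E" "connected_graph V E" "connected_graph V (complement_edges V E)"
    and "trc V E + trc V (complement_edges V E) = 2 * n"
proof -
  let ?F = "complement_edges V E"
  have adj: "{i, j} \<in> E \<longleftrightarrow> i < n \<and> j < n \<and> (j = Suc i \<or> i = Suc j)" for i j
    by (auto simp: E doubleton_eq_iff)
  have adjF: "{i, j} \<in> ?F \<longleftrightarrow> i < n \<and> j < n \<and> i \<noteq> j \<and> j \<noteq> Suc i \<and> i \<noteq> Suc j" for i j
    by (auto simp: complement_edges_def adj V card_insert_if)
  have memV: "i \<in> V \<longleftrightarrow> i < n" for i by (simp add: V)
  show G: "simple_graph V E" by (auto simp: simple_graph_def V E)
  show cE: "connected_graph V E"
  proof (rule connected_graph_rankI[of 0 _ _ id])
    fix u assume "u \<in> V" "u \<noteq> 0"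
    then show "\<exists>u'\<in>V. {u, u'} \<in> E \<and> id u' < id u"
      by (intro bexI[of _ "u - 1"]) (auto simp: adj memV)
  qed (use n memV in simp)
  show cF: "connected_graph V ?F"
  \<comment> \<open>In the complement, 0 is adjacent to all other vertices but 1, and 1 is adjacent
    to 3.\<close>
  proof (rule connected_graph_rankI[of 0 _ _ "\<lambda>i. if i = 0 then 0 else if i = 1 then 2 else 1"])
    fix u assume u: "u \<in> V" "u \<noteq> 0"
    show "\<exists>u'\<in>V. {u, u'} \<in> ?F \<and> (if u' = 0 then 0 else if u' = 1 then 2 else 1)
        < (if u = 0 then 0 else if u = 1 then 2 else (1::nat))"
    proof (cases "u = 1")
      case True
      then show ?thesis using n by (intro bexI[of _ 3]) (auto simp: adjF memV)
    next
      case False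
      then show ?thesis using u n by (intro bexI[of _ 0]) (auto simp: adjF memV)
    qed
  qed (use n memV in simp)
  have C: "complementary V E ?F" by (rule complementary_complement_edges[OF G cE cF])
  note D = complementaryD[OF C]
  obtain k l where kl: "colorable V E k" "colorable V ?F l"
    using sum_colorable_upper_bound[OF C] n V unfolding sum_colorable_def by auto
  have "n \<le> length p" if p: "path_between V E 0 p (n - 1)" for p
  proof -
    have "i \<in> set p" if "i < n" for i
    proof (cases "i = n - 1")
      case True
      then show ?thesis using p by (metis last_in_set path_between_def)
    next
      case False
      \<comment> \<open>The only edge leaving \<open>{..i}\<close> is \<open>{i, Suc i}\<close>, so
        a path between the ends must use it.\<close>
      then have "{i, Suc i} \<in> set (path_edges p)"
        by (intro path_contains_bridge[OF p, of "{..i}"]) (use that in \<open>auto simp: adj\<close>)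
      then show ?thesis using set_path_edges_subset by blast
    qed
    then have "card {..<n} \<le> card (set p)" by (intro card_mono) auto
    then show ?thesis using card_length[of p] by simp
  qed
  then have "2 * n - 3 \<le> trc V E"
    by (rule trc_ge_path_length[OF kl(1) D(1), rotated 4]) (use D(4) memV n in auto)
  moreover have "2 * 3 - 3 \<le> trc V ?F"
    by (rule trc_ge_path_length[OF kl(2) D(1), of 0 1])
      (use D(5) memV n in \<open>auto intro: path_length_ge_3 simp: adjF\<close>)
  moreover have "trc V E + trc V ?F \<le> 2 * n"
    using trc_sum_le[OF sum_colorable_upper_bound[OF C]] n V by simp
  ultimately show "trc V E + trc V ?F = 2 * n" using n by simp
qed

text \<open>All four edges of the fork are bridges; with the internal vertices 0 and 1 they make six
  items whose colors must differ pairwise. In the complement, 0 and 1 have distance three, which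
  forces five colors.\<close>

lemma fork_trc:
  defines "V \<equiv> {0, 1, 2, 3, 4 :: nat}" and "E \<equiv> {{0, 1}, {0, 2}, {0, 3}, {1, 4 :: nat}}"
  shows "simple_graph V E" "connected_graph V E" "connected_graph V (complement_edges V E)"
    and "trc V E + trc V (complement_edges V E) = 11"
proof -
  let ?F = "complement_edges V E"
  show G: "simple_graph V E" by (simp add: simple_graph_def V_def E_def)
  show cE: "connected_graph V E"
  proof (rule connected_graph_rankI[of 0 _ _ id])
    fix u assume "u \<in> V" "u \<noteq> 0"
    then consider "u = 1" | "u = 2" | "u = 3" | "u = 4" unfolding V_def by blast
    then show "\<exists>u'\<in>V. {u, u'} \<in> E \<and> id u' < id u"
      by cases (simp_all add: V_def E_def doubleton_eq_iff)
  qed (simp add: V_def)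
  show cF: "connected_graph V ?F"
  \<comment> \<open>The rank is zero at 0 and falls with the vertex number elsewhere: in the
    complement each of 1, 2, 3 has an edge to a larger number, and 4 has one to 0.\<close>
  proof (rule connected_graph_rankI[of 0 _ _ "\<lambda>i. 10 - i - (if i = 0 then 10 else 0)"])
    fix u assume "u \<in> V" "u \<noteq> 0"
    then consider "u = 1" | "u = 2" | "u = 3" | "u = 4" unfolding V_def by blast
    then show "\<exists>u'\<in>V. {u, u'} \<in> ?F \<and> 10 - u' - (if u' = 0 then 10 else 0)
        < 10 - u - (if u = 0 then 10 else 0)"
      by cases (simp_all add: V_def E_def complement_edges_def doubleton_eq_iff)
  qed (simp add: V_def)
  have C: "complementary V E ?F" by (rule complementary_complement_edges[OF G cE cF])
  note D = complementaryD[OF C]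
  have fork: "fork V E ?F"
    unfolding fork_def
    by (rule exI[of _ 0], rule exI[of _ 1], rule exI[of _ 2], rule exI[of _ 3], rule exI[of _ 4])
      (simp add: V_def E_def complement_edges_def doubleton_eq_iff)
  note sum = sum_colorable_fork[OF C fork]
  then obtain k l where kl: "colorable V E k" "colorable V ?F l"
    unfolding sum_colorable_def by blast
  have adj: "{x, y} \<in> E \<longleftrightarrow> {x, y} = {0, 1} \<or> {x, y} = {0, 2} \<or> {x, y} = {0, 3} \<or> {x, y} = {1, 4}"
    for x y by (auto simp: E_def)
  have "6 \<le> trc V E"
  proof -
    obtain c where c: "total_rainbow_connected V E c" "card (colors_used V E c) = trc V E"
      using trc_attained[OF kl(1)] by blast
    have bridge: "e \<in> set (path_edges p) \<and> (\<forall>x\<in>e. x \<noteq> u \<longrightarrow> x \<noteq> v \<longrightarrow> x \<in> set (internal_vertices p))"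
      if "path_between V E u p v" "u \<in> S" "v \<notin> S"
        "\<And>x y. x \<in> S \<Longrightarrow> y \<notin> S \<Longrightarrow> {x, y} \<in> E \<Longrightarrow> {x, y} = e" for u v p S e
      using path_contains_bridge[OF that] set_path_edges_subset[of e p] internal_if_not_end[OF that(1)]
      by blast
    have inj: "inj_on c (Inr ` set (path_edges p) \<union> Inl ` set (internal_vertices p))"
      if "total_rainbow c p" for p
      using that unfolding total_rainbow_def distinct_map by simp
    \<comment> \<open>Each of these sets is left by a single edge; the last one takes the place of
      \<open>{3}\<close> for a path that ends in 3.\<close>
    have cuts:
      "\<And>x y. x \<in> {2} \<Longrightarrow> y \<notin> {2} \<Longrightarrow> {x, y} \<in> E \<Longrightarrow> {x, y} = {0, 2}"
      "\<And>x y. x \<in> {3} \<Longrightarrow> y \<notin> {3} \<Longrightarrow> {x, y} \<in> E \<Longrightarrow> {x, y} = {0, 3}"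
      "\<And>x y. x \<in> {0, 2, 3} \<Longrightarrow> y \<notin> {0, 2, 3} \<Longrightarrow> {x, y} \<in> E \<Longrightarrow> {x, y} = {0, 1}"
      "\<And>x y. x \<in> {0, 1, 2, 3} \<Longrightarrow> y \<notin> {0, 1, 2, 3} \<Longrightarrow> {x, y} \<in> E \<Longrightarrow> {x, y} = {1, 4}"
      "\<And>x y. x \<in> {0, 1, 2, 4} \<Longrightarrow> y \<notin> {0, 1, 2, 4} \<Longrightarrow> {x, y} \<in> E \<Longrightarrow> {x, y} = {0, 3}"
      by (auto simp: adj doubleton_eq_iff)
    obtain p where p: "path_between V E 2 p 4" "total_rainbow c p"
      using c(1) unfolding total_rainbow_connected_def V_def by fastforce
    have "{0, 2} \<in> set (path_edges p) \<and> 0 \<in> set (internal_vertices p)"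
      using bridge[OF p(1), of "{2}" "{0, 2}", OF _ _ cuts(1)] by simp
    moreover have "{0, 1} \<in> set (path_edges p) \<and> 1 \<in> set (internal_vertices p)"
      using bridge[OF p(1), of "{0, 2, 3}" "{0, 1}", OF _ _ cuts(3)] by simp
    moreover have "{1, 4} \<in> set (path_edges p)"
      using bridge[OF p(1), of "{0, 1, 2, 3}" "{1, 4}", OF _ _ cuts(4)] by simp
    ultimately have inj1:
      "inj_on c {Inr {0, 2}, Inr {0, 1}, Inr {1, 4}, Inl 0, Inl 1}"
      by (intro inj_on_subset[OF inj[OF p(2)]]) auto
    obtain q where q: "path_between V E 3 q 4" "total_rainbow c q"
      using c(1) unfolding total_rainbow_connected_def V_def by fastforce
    have "{0, 3} \<in> set (path_edges q) \<and> 0 \<in> set (internal_vertices q)"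
      using bridge[OF q(1), of "{3}" "{0, 3}", OF _ _ cuts(2)] by simp
    moreover have "{0, 1} \<in> set (path_edges q) \<and> 1 \<in> set (internal_vertices q)"
      using bridge[OF q(1), of "{0, 2, 3}" "{0, 1}", OF _ _ cuts(3)] by simp
    moreover have "{1, 4} \<in> set (path_edges q)"
      using bridge[OF q(1), of "{0, 1, 2, 3}" "{1, 4}", OF _ _ cuts(4)] by simp
    ultimately have inj2:
      "inj_on c {Inr {0, 3}, Inr {0, 1}, Inr {1, 4}, Inl 0, Inl 1}"
      by (intro inj_on_subset[OF inj[OF q(2)]]) auto
    obtain r where r: "path_between V E 2 r 3" "total_rainbow c r"
      using c(1) unfolding total_rainbow_connected_def V_def by fastforce
    have "{0, 2} \<in> set (path_edges r)"
      using bridge[OF r(1), of "{2}" "{0, 2}", OF _ _ cuts(1)] by simp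
    moreover have "{0, 3} \<in> set (path_edges r)"
      using bridge[OF r(1), of "{0, 1, 2, 4}" "{0, 3}", OF _ _ cuts(5)] by simp
    ultimately have inj3: "inj_on c {Inr {0, 2}, Inr {0, 3}}"
      by (intro inj_on_subset[OF inj[OF r(2)]]) auto
    \<comment> \<open>The paths from 2 and from 3 to 4 separate all pairs of these items except the
      edges \<open>{0, 2}\<close> and \<open>{0, 3}\<close>, which the path from 2 to 3
      separates.\<close>
    let ?A = "{Inr {0, 2}, Inr {0, 3}, Inr {0, 1}, Inr {1, 4}, Inl 0, Inl 1 :: nat + nat set}"
    have "inj_on c ?A" using inj1 inj2 inj3 by (auto simp: inj_on_insert doubleton_eq_iff)
    then have "card (c ` ?A) = card ?A" by (rule card_image)
    also have "card ?A = 6" by (simp add: doubleton_eq_iff)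
    finally have "6 = card (c ` ?A)" ..
    also have "\<dots> \<le> card (colors_used V E c)"
    proof (rule card_mono)
      show "finite (colors_used V E c)" using finite_colors_used D(1,4) by blast
      have "?A \<subseteq> Inl ` V \<union> Inr ` E" by (auto simp: V_def E_def)
      then show "c ` ?A \<subseteq> colors_used V E c" unfolding colors_used_def by (rule image_mono)
    qed
    finally show ?thesis using c(2) by simp
  qed
  moreover have "2 * 4 - 3 \<le> trc V ?F"
  proof (rule trc_ge_path_length[OF kl(2) D(1), of 0 1])
    have "{x, 1} \<notin> ?F" if "{0, x} \<in> ?F" for x
      using that by (auto simp: complement_edges_def V_def E_def insert_commute)
    moreover have "{0, 1} \<notin> ?F" by (simp add: complement_edges_def E_def)
    ultimately show "4 \<le> length p" if "path_between V ?F 0 p 1" for p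
      using path_length_ge_4[OF that] by simp
  qed (use D(5) in \<open>auto simp: V_def\<close>)
  moreover have "trc V E + trc V ?F \<le> 11" by (rule trc_sum_le[OF sum])
  ultimately show "trc V E + trc V ?F = 11" by simp
qed

theorem theorem4p5:
  shows "(\<forall>(V :: 'a set) E n.
            simple_graph V E \<and> card V = n \<and> n \<ge> 4 \<and>
            connected_graph V E \<and> connected_graph V (complement_edges V E) \<longrightarrow>
              (n = 4 \<longrightarrow> trc V E + trc V (complement_edges V E) = 2 * n + 2) \<and>
              (n = 5 \<longrightarrow> trc V E + trc V (complement_edges V E) \<le> 2 * n + 1) \<and>
              (n \<ge> 6 \<longrightarrow> trc V E + trc V (complement_edges V E) \<le> 2 * n)) \<and>
         (\<forall>n \<ge> 5. \<exists>(V :: nat set) E.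
            simple_graph V E \<and> card V = n \<and>
            connected_graph V E \<and> connected_graph V (complement_edges V E) \<and>
            trc V E + trc V (complement_edges V E) = (if n = 5 then 2 * n + 1 else 2 * n))"
proof (intro conjI allI impI)
  fix V :: "'a set" and E n
  assume H: "simple_graph V E \<and> card V = n \<and> n \<ge> 4 \<and>
    connected_graph V E \<and> connected_graph V (complement_edges V E)"
  let ?F = "complement_edges V E"
  have C: "complementary V E ?F" using H by (intro complementary_complement_edges) auto
  show "trc V E + trc V ?F = 2 * n + 2" if n: "n = 4"
  proof -
    obtain a b c d where V: "distinct [a, b, c, d]" "V = {a, b, c, d}" "path4 E ?F a b c d"
      using order4_path[OF C] H n by blast
    have W: "distinct [b, d, a, c]" "V = {b, d, a, c}" using V by auto
    show ?thesis
      using order4_trc[OF C V] n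
        order4_trc[OF complementary_sym[OF C] W path4_complement[OF V(3)]] by simp
  qed
  show "trc V E + trc V ?F \<le> 2 * n + 1" if "n = 5"
  proof -
    have "sum_colorable V E ?F 10 \<or> fork V E ?F \<or> fork V ?F E"
      using order5[OF C] H that by blast
    then have "sum_colorable V E ?F 10 \<or> sum_colorable V E ?F 11"
      using sum_colorable_fork C complementary_sym sum_colorable_sym by blast
    then show ?thesis using trc_sum_le[of V E ?F] that by fastforce
  qed
  show "trc V E + trc V ?F \<le> 2 * n" if "n \<ge> 6"
    using trc_sum_le[OF sum_colorable_upper_bound[OF C]] H that by simp
next
  fix n :: nat assume n: "5 \<le> n"
  show "\<exists>(V :: nat set) E. simple_graph V E \<and> card V = n \<and>
      connected_graph V E \<and> connected_graph V (complement_edges V E) \<and>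
      trc V E + trc V (complement_edges V E) = (if n = 5 then 2 * n + 1 else 2 * n)"
  proof (cases "n = 5")
    case True
    then show ?thesis using fork_trc by (intro exI conjI) auto
  next
    case False
    then have "6 \<le> n" using n by simp
    note P = path_graph_trc[OF this refl refl]
    show ?thesis
      by (intro exI conjI) (rule P(1), simp, rule P(2), rule P(3), use P(4) False in simp)
  qed
qed

end
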